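(* Let $N\geq 1$ be an integer and $\boldsymbol{h}=(h_1,\ldots,h_N)\in\mathbb{C}^N$. Let $L_{\boldsymbol{h}}$ be the operator $-\mathrm{d}^2/\mathrm{d}x^2$ acting componentwise in $L^2\big((0,1),\mathbb{C}^N\big)$ with domain consisting of all $\boldsymbol{u}=(u_1,\ldots,u_N)\in W_2^2\big((0,1),\mathbb{C}^N\big)$ satisfying $u_1(1)=u_2(1)=\cdots=u_N(1)$, $\ u_1'(1)+\cdots+u_N'(1)=0$, and $u_j'(0)=h_j u_j(0)$ for $1\leq j\leq N$. Then the spectrum of $L_{\boldsymbol{h}}$ possesses reflection symmetry with respect to the real line (i.e. $\lambda$ is in the spectrum if and only if $\overline{\lambda}$ is) if and only if the $N$-tuple $\boldsymbol{h}$ of Robin parameters is invariant under conjugation.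
   Context: This $L_{\boldsymbol{h}}$ is the Laplacian on the equilateral star graph with $N$ unit-length edges, standard vertex conditions at the central vertex (the point $1$ of each edge) and Robin conditions with complex parameters $h_j$ at the degree-one vertices (the point $0$). An $N$-tuple $\boldsymbol{c}=(c_1,\ldots,c_N)$ of complex numbers is called invariant under conjugation if its non-real components can be grouped into pairs of mutually complex-conjugate components (equivalently, there is a permutation $\sigma$ of $\{1,\ldots,N\}$ with $\overline{c_i}=c_{\sigma(i)}$ for all $i$). *)

theory Defs
  imports "HOL-Analysis.Analysis"
begin

text \<open>Square integrable functions on (0,1) (representatives; equality a.e. is handled
  where needed).\<close>
definition L2fun :: "(real \<Rightarrow> complex) \<Rightarrow> bool" where
  "L2fun g \<longleftrightarrow> g absolutely_integrable_on {0..1} \<and>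
                 (\<lambda>x. (cmod (g x))^2) integrable_on {0..1}"

text \<open>u belongs to W_2^2(0,1): u is continuously differentiable on [0,1] with derivative u',
  u' is absolutely continuous with (a.e.) derivative g, and g is in L^2(0,1).\<close>
definition W22 :: "(real \<Rightarrow> complex) \<Rightarrow> (real \<Rightarrow> complex) \<Rightarrow> (real \<Rightarrow> complex) \<Rightarrow> bool" where
  "W22 u u' g \<longleftrightarrow> continuous_on {0..1} u' \<and> L2fun g \<and>
     (\<forall>x\<in>{0..1}. u x = u 0 + integral {0..x} u' \<and> u' x = u' 0 + integral {0..x} g)"

definition star_dom :: "nat \<Rightarrow> (nat \<Rightarrow> complex) \<Rightarrow> (nat \<Rightarrow> real \<Rightarrow> complex)
     \<Rightarrow> (nat \<Rightarrow> real \<Rightarrow> complex) \<Rightarrow> (nat \<Rightarrow> real \<Rightarrow> complex) \<Rightarrow> bool" where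
  "star_dom N h u u' g \<longleftrightarrow>
     (\<forall>j<N. W22 (u j) (u' j) (g j)) \<and>
     (\<forall>j<N. \<forall>k<N. u j 1 = u k 1) \<and>
     (\<Sum>j<N. u' j 1) = 0 \<and>
     (\<forall>j<N. u' j 0 = h j * u j 0)"

definition star_eq :: "nat \<Rightarrow> complex \<Rightarrow> (nat \<Rightarrow> real \<Rightarrow> complex)
     \<Rightarrow> (nat \<Rightarrow> real \<Rightarrow> complex) \<Rightarrow> (nat \<Rightarrow> real \<Rightarrow> complex) \<Rightarrow> bool" where
  "star_eq N lam u g f \<longleftrightarrow>
     (\<forall>j<N. AE x in lborel. x \<in> {0..1} \<longrightarrow> - g j x - lam * u j x = f j x)"

text \<open>Resolvent set: L_h - \<lambda> is a bijection from its domain onto L^2((0,1),C^N)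
  (L_h is closed, so the inverse is automatically bounded). Spectrum = complement.\<close>
definition star_resolvent :: "nat \<Rightarrow> (nat \<Rightarrow> complex) \<Rightarrow> complex set" where
  "star_resolvent N h = {lam.
     \<forall>f. (\<forall>j<N. L2fun (f j)) \<longrightarrow>
       (\<exists>u u' g. star_dom N h u u' g \<and> star_eq N lam u g f) \<and>
       (\<forall>u1 u1' g1 u2 u2' g2.
          star_dom N h u1 u1' g1 \<and> star_eq N lam u1 g1 f \<and>
          star_dom N h u2 u2' g2 \<and> star_eq N lam u2 g2 f \<longrightarrow>
          (\<forall>j<N. \<forall>x\<in>{0..1}. u1 j x = u2 j x))}"

definition star_spectrum :: "nat \<Rightarrow> (nat \<Rightarrow> complex) \<Rightarrow> complex set" where
  "star_spectrum N h = - star_resolvent N h"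

definition conj_invariant :: "nat \<Rightarrow> (nat \<Rightarrow> complex) \<Rightarrow> bool" where
  "conj_invariant N c \<longleftrightarrow>
     (\<exists>\<sigma>. bij_betw \<sigma> {..<N} {..<N} \<and> (\<forall>i<N. cnj (c i) = c (\<sigma> i)))"

end

theory Submission
  imports Defs
    "HOL-Complex_Analysis.Complex_Analysis"
    "HOL-Real_Asymp.Real_Asymp"
    "HOL-Computational_Algebra.Field_as_Ring"
    "HOL-Computational_Algebra.Polynomial_Factorial"
    "HOL-Combinatorics.Permutations"
begin

text \<open>
  Put \<open>\<lambda> = z\<^sup>2\<close>, \<open>c = cos z\<close>, \<open>s = sin z / z\<close> and \<open>p(x) = \<Prod>(x + h_j)\<close>.  The solution on edge j
  satisfying the Robin condition has value \<open>c + h_j s\<close> and derivative \<open>h_j c - z\<^sup>2 s\<close> at 1, so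
  \<open>\<lambda>\<close> is in the spectrum iff the determinant of the vertex conditions vanishes.  For \<open>s \<noteq> 0\<close>
  and \<open>x = c / s\<close> this reads \<open>N x p(x) = (x\<^sup>2 + \<lambda>) p'(x)\<close>.

  If the spectrum is symmetric, every spectral point also satisfies this equation for the
  conjugate polynomial \<open>p*\<close>; since \<open>x\<^sup>2 + \<lambda> = 1 / s\<^sup>2\<close> is nonzero, \<open>p p*' - p* p'\<close> vanishes at x.
  The spectrum is symmetric only as a set, so multiplicities are not available, but
  infinitely many distinct values x suffice to give \<open>p = p*\<close>.  After cancelling common factors
  of \<open>x p\<close> and \<open>p'\<close>, the determinant is an entire function of \<open>\<lambda>\<close> of order 1/2 growing
  exponentially along the negative axis, hence has infinitely many zeros, unless
  \<open>N x p = (x\<^sup>2 + e) p'\<close> for a constant e.  In this exceptional case e itself is an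
  eigenvalue, and the symmetry applied to it forces e to be real, whence again \<open>p = p*\<close>.
\<close>

section \<open>Entire functions of order one half\<close>

text \<open>\<open>csqrt\<close> is holomorphic off the nonpositive real axis, and
  \<open>\<i> * csqrt (- w)\<close> is a holomorphic root off the nonnegative one. An even F does
  not see which root is taken, so the two pieces glue on the punctured plane; continuity removes the
  singularity at 0.\<close>

lemma holomorphic_even_csqrt:
  fixes F :: "complex \<Rightarrow> complex"
  assumes hol: "F holomorphic_on UNIV" and even: "\<And>z. F (- z) = F z"
  shows "(\<lambda>w. F (csqrt w)) holomorphic_on UNIV"
proof (rule no_isolated_singularity'[where K = "{0}"])
  let ?A = "- \<real>\<^sub>\<le>\<^sub>0 :: complex set"
  have F: "F holomorphic_on A" for A
    using hol holomorphic_on_subset by blast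
  have 1: "(\<lambda>w. F (csqrt w)) holomorphic_on ?A"
    by (rule holomorphic_on_compose[OF _ F, unfolded o_def]) (intro holomorphic_intros)
  have "(\<lambda>w. F (\<i> * csqrt (- w))) holomorphic_on uminus ` ?A"
    by (rule holomorphic_on_compose[OF _ F, unfolded o_def]) (auto intro!: holomorphic_intros)
  moreover have "F (\<i> * csqrt (- w)) = F (csqrt w)" for w
  proof -
    have "(\<i> * csqrt (- w))\<^sup>2 = (csqrt w)\<^sup>2"
      by (simp add: power_mult_distrib)
    then have "\<i> * csqrt (- w) = csqrt w \<or> \<i> * csqrt (- w) = - csqrt w"
      by (simp only: power2_eq_iff)
    then show ?thesis
      using even by auto
  qed
  ultimately have 2: "(\<lambda>w. F (csqrt w)) holomorphic_on uminus ` ?A"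
    by simp
  have "open ?A"
    by (simp add: open_Compl)
  then have "open (uminus ` ?A)"
    by (rule open_negations)
  then have "(\<lambda>w. F (csqrt w)) holomorphic_on (?A \<union> uminus ` ?A)"
    using 1 2 \<open>open ?A\<close> by (intro holomorphic_on_Un) auto
  moreover have "w \<in> ?A \<union> uminus ` ?A" if "w \<noteq> 0" for w
  proof (rule ccontr)
    assume "w \<notin> ?A \<union> uminus ` ?A"
    then have "w \<in> \<real>\<^sub>\<le>\<^sub>0" "- w \<in> \<real>\<^sub>\<le>\<^sub>0"
      using image_eqI[of w uminus "- w" ?A] by auto
    then show False
      using that by (auto simp: complex_nonpos_Reals_iff complex_eq_iff)
  qed
  ultimately show "(\<lambda>w. F (csqrt w)) holomorphic_on (UNIV - {0})"
    by (elim holomorphic_on_subset) auto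
  show "((\<lambda>w. F (csqrt w)) \<longlongrightarrow> F (csqrt z)) (at z within UNIV)" if "z \<in> {0}" for z
  proof -
    have "((\<lambda>z::complex. sqrt (norm z)) \<longlongrightarrow> sqrt (norm (0::complex))) (at 0)"
      by (rule tendsto_real_sqrt, rule tendsto_norm, rule tendsto_ident_at)
    then have "(csqrt \<longlongrightarrow> 0) (at 0)"
      by (subst tendsto_norm_zero_iff[symmetric]) simp
    moreover have "isCont F 0"
      using holomorphic_on_imp_continuous_on[OF hol] by (simp add: continuous_on_eq_continuous_at)
    ultimately show ?thesis
      using that isCont_tendsto_compose by force
  qed
qed auto

text \<open>The nonvanishing factor of the local expansion at z and the global quotient
  \<open>G w / (w - z) ^ n\<close> agree near z away from z itself, so together they define one
  entire function.\<close>

lemma entire_divide_zero: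
  assumes hol: "G holomorphic_on UNIV" and zero: "G z = 0" and nz: "\<exists>w. G w \<noteq> 0"
  obtains n k where "k holomorphic_on UNIV" "k z \<noteq> 0" "\<And>w. G w = (w - z) ^ n * k w"
proof -
  define g n where "g = zor_poly G z" and "n = nat (zorder G z)"
  obtain r where r: "r > 0" "g holomorphic_on cball z r"
      "\<forall>w\<in>cball z r. G w = g w * (w - z) ^ n \<and> g w \<noteq> 0"
    using zorder_exist_zero[OF hol, of z] nz unfolding g_def n_def by auto
  define k where "k = (\<lambda>w. if w = z then g z else G w / (w - z) ^ n)"
  \<comment> \<open>At \<open>w = z\<close> the factorisation reads \<open>0 = 0 ^ n * k z\<close>
    with \<open>k z\<close> nonzero, so it needs a positive exponent.\<close>
  have "n \<noteq> 0"
    using r zero by (metis centre_in_cball less_imp_le mult_1_right power_0)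
  have 1: "k w = g w" if "w \<in> ball z r" for w
    using r that by (auto simp: k_def)
  have "k holomorphic_on ball z r"
    using r(2) by (subst holomorphic_cong[OF refl 1]) (auto intro: holomorphic_on_subset)
  moreover have "(\<lambda>w. G w / (w - z) ^ n) holomorphic_on (- {z})"
    using hol by (intro holomorphic_intros) (auto intro: holomorphic_on_subset)
  then have "k holomorphic_on - {z}"
    by (rule holomorphic_transform) (auto simp: k_def)
  ultimately have "k holomorphic_on (ball z r \<union> - {z})"
    by (intro holomorphic_on_Un) auto
  moreover have "ball z r \<union> - {z} = UNIV"
    using r(1) by auto
  moreover have "k z \<noteq> 0"
    using r by (simp add: k_def)
  moreover have "G w = (w - z) ^ n * k w" for w
    using zero \<open>n \<noteq> 0\<close> by (simp add: k_def)
  ultimately show ?thesis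
    using that by metis
qed

text \<open>Induction on the number of distinct zeros: dividing out one zero to its full order
  removes it from the zero set and adds no other.\<close>

lemma entire_finite_zeros_factor:
  assumes "finite {w. G w = 0}" "G holomorphic_on UNIV"
  shows "\<exists>Q k. k holomorphic_on UNIV \<and> (\<forall>w. k w \<noteq> 0) \<and> (\<forall>w::complex. G w = poly Q w * k w)"
  using assms
proof (induction "card {w. G w = 0}" arbitrary: G rule: less_induct)
  case less
  show ?case
  proof (cases "{w. G w = 0} = {}")
    case True
    then show ?thesis
      using less.prems by (intro exI[of _ 1] exI[of _ G]) auto
  next
    case False
    then obtain z where z: "G z = 0"
      by auto
    have "\<exists>w. G w \<noteq> 0"
      using less.prems(1) infinite_UNIV_char_0[where 'a = complex] by (auto intro: ccontr)
    then obtain n k where k: "k holomorphic_on UNIV" "k z \<noteq> 0" "\<And>w. G w = (w - z) ^ n * k w"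
      using entire_divide_zero less.prems(2) z by metis
    have "{w. k w = 0} \<subset> {w. G w = 0}"
      using k z by auto
    then have "card {w. k w = 0} < card {w. G w = 0}" "finite {w. k w = 0}"
      using less.prems(1) by (auto intro: psubset_card_mono finite_subset)
    from less.hyps[OF this k(1)] obtain Q k' where
      "k' holomorphic_on UNIV" "\<forall>w. k' w \<noteq> 0" "\<forall>w. k w = poly Q w * k' w"
      by auto
    then show ?thesis
      using k(3) by (intro exI[of _ "[:-z, 1:] ^ n * Q"] exI[of _ k']) auto
  qed
qed

text \<open>Borel--Caratheodory by the Schwarz lemma applied to \<open>g / (2M - g)\<close> on the disc of radius R.\<close>

lemma norm_le_of_Re_bounded:
  assumes hol: "g holomorphic_on UNIV" and g0: "g 0 = 0" and M: "M > 0"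
    and bnd: "\<And>z. norm z < R \<Longrightarrow> Re (g z) < M" and w: "norm w < R"
  shows "norm (g w) * (R - norm w) \<le> 2 * M * norm w"
proof -
  have R: "R > 0"
    using w norm_ge_zero[of w] by linarith
  define f where "f = (\<lambda>z::complex. g (R * z) / (2 * M - g (R * z)))"
  have less: "Re (g (R * z)) < M" if "norm z < 1" for z :: complex
    using bnd[of "R * z"] that R by (simp add: norm_mult)
  have ne: "2 * M - g (R * z) \<noteq> 0" if "norm z < 1" for z :: complex
    using less[OF that] M by (auto simp: complex_eq_iff)
  have "(\<lambda>z. g (R * z)) holomorphic_on ball 0 1"
    by (rule holomorphic_on_compose[OF _ holomorphic_on_subset[OF hol], unfolded o_def])
       (auto intro!: holomorphic_intros)
  then have "f holomorphic_on ball 0 1"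
    unfolding f_def using ne by (intro holomorphic_intros) auto
  moreover have "norm (f z) < 1" if "norm z < 1" for z
  proof -
    define x where "x = g (R * z)"
    have "Re x < M"
      unfolding x_def by (rule less[OF that])
    \<comment> \<open>The half-plane \<open>Re x < M\<close> consists of the points closer to 0 than
      to \<open>2 * M\<close>. The imaginary parts of x and \<open>2 * M - x\<close> agree in
      modulus, so comparing real parts is enough.\<close>
    then have "(Re x)\<^sup>2 < (2 * M - Re x)\<^sup>2"
      using M by (simp add: power2_eq_square algebra_simps)
    then have "(norm x)\<^sup>2 < (norm (2 * M - x))\<^sup>2"
      by (simp add: cmod_power2)
    then have "norm x < norm (2 * M - x)"
      using power2_less_imp_less norm_ge_zero by blast
    then show ?thesis
      using ne[OF that] by (simp add: f_def x_def norm_divide divide_simps)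
  qed
  moreover have "f 0 = 0"
    by (simp add: f_def g0)
  moreover have w': "norm (w / R) < 1"
    using w R by (simp add: norm_divide)
  ultimately have "norm (f (w / R)) \<le> norm (w / R)"
    using Schwarz_Lemma(1) by blast
  then have "norm (g w) * R \<le> norm w * norm (2 * M - g w)"
    using R ne[OF w'] by (simp add: f_def norm_divide divide_simps mult.commute)
  also have "\<dots> \<le> norm w * (2 * M + norm (g w))"
    using norm_triangle_ineq4[of "2 * complex_of_real M" "g w"] M by (intro mult_left_mono) auto
  finally show ?thesis
    by (simp add: algebra_simps)
qed

text \<open>The preceding bound on the disc of radius R gives \<open>norm (g w - g 0)\<close> of
  order \<open>sqrt R / R\<close> for fixed w, which tends to 0 as R grows.\<close>

lemma entire_Re_le_sqrt_imp_const:
  assumes hol: "g holomorphic_on UNIV" and bnd: "\<And>z. Re (g z) \<le> K * sqrt (norm z) + C"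
  shows "g w = g 0"
proof -
  \<comment> \<open>The absolute values cover negative K and C, \<open>norm (g 0)\<close> pays for
    subtracting \<open>g 0\<close>, and the summand 1 makes the bound strict and M positive.\<close>
  define M where "M = (\<lambda>R. \<bar>K\<bar> * sqrt R + \<bar>C\<bar> + norm (g 0) + 1)"
  have le: "norm (g w - g 0) * (R - norm w) \<le> 2 * M R * norm w" if R: "norm w < R" for R
  proof (rule norm_le_of_Re_bounded[where g = "\<lambda>z. g z - g 0"])
    have "R > 0"
      using R norm_ge_zero[of w] by linarith
    then show "M R > 0"
      unfolding M_def by (intro add_nonneg_pos add_nonneg_nonneg) auto
    fix z :: complex
    assume z: "norm z < R"
    have "Re (g z - g 0) \<le> K * sqrt (norm z) + C + norm (g 0)"
      using bnd[of z] abs_Re_le_cmod[of "g 0"] by simp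
    also have "K * sqrt (norm z) \<le> \<bar>K\<bar> * sqrt R"
      using z by (intro mult_mono) auto
    finally show "Re (g z - g 0) < M R"
      unfolding M_def by linarith
  qed (use hol R in \<open>auto intro!: holomorphic_intros\<close>)
  have "norm (g w - g 0) \<le> 0"
  proof (rule tendsto_le)
    show "((\<lambda>R. 2 * M R * norm w / (R - norm w)) \<longlongrightarrow> 0) at_top"
      unfolding M_def by real_asymp
    show "\<forall>\<^sub>F R in at_top. norm (g w - g 0) \<le> 2 * M R * norm w / (R - norm w)"
      using eventually_gt_at_top[of "norm w"] by eventually_elim (use le in \<open>simp add: field_simps\<close>)
  qed (auto intro: tendsto_const)
  then show ?thesis
    by simp
qed

text \<open>A simple case of Hadamard's theorem: k has an entire logarithm, whose real part grows at
  most like the square root of the modulus and which is therefore constant.\<close>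

lemma nonvanishing_entire_exp_sqrt_const:
  assumes hol: "k holomorphic_on UNIV" and nz: "\<And>z. k z \<noteq> 0"
    and bnd: "\<And>z. norm (k z) \<le> C * exp (K * sqrt (norm z))"
  shows "k w = k 0"
proof -
  obtain g where g: "g holomorphic_on UNIV" "\<And>z. exp (g z) = k z"
    using holomorphic_logarithm_exists[OF convex_UNIV open_UNIV hol nz, of 0] by auto
  have C: "C > 0"
    using bnd[of 0] nz[of 0] zero_less_norm_iff[of "k 0"] by (simp del: zero_less_norm_iff)
  have "Re (g z) \<le> K * sqrt (norm z) + ln C" for z
  proof -
    have "exp (Re (g z)) \<le> C * exp (K * sqrt (norm z))"
      using bnd[of z] by (simp flip: g(2))
    also have "\<dots> = exp (K * sqrt (norm z) + ln C)"
      using C by (simp add: exp_add)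
    finally show ?thesis
      by simp
  qed
  then have "g w = g 0"
    using entire_Re_le_sqrt_imp_const g(1) by blast
  then show ?thesis
    by (simp flip: g(2))
qed

text \<open>Split off a polynomial Q carrying the zeros. Outside a large disc Q is bounded away from
  0, inside it the cofactor is bounded by compactness; so the cofactor inherits the growth bound
  and, having no zeros, is constant.\<close>

lemma entire_exp_sqrt_finite_zeros_imp_poly:
  assumes hol: "G holomorphic_on UNIV" and fin: "finite {z. G z = 0}"
    and bnd: "\<And>z. norm (G z) \<le> C * exp (K * sqrt (norm z))" and K: "K \<ge> 0"
  obtains Q where "\<And>z::complex. G z = poly Q z"
proof -
  obtain Q k where k: "k holomorphic_on UNIV" "\<And>w. k w \<noteq> 0" "\<And>w. G w = poly Q w * k w"
    using entire_finite_zeros_factor[OF fin hol] by blast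
  have Q: "Q \<noteq> 0"
    using k(3) fin infinite_UNIV_char_0[where 'a = complex] by auto
  \<comment> \<open>The bound \<open>norm (lead_coeff Q) / 2\<close> also holds for a constant Q; in
    positive degree Q tends to infinity and any constant is eventually exceeded.\<close>
  have "\<exists>B>0. \<forall>z. norm z \<ge> B \<longrightarrow> norm (poly Q z) \<ge> norm (lead_coeff Q) / 2"
  proof (cases "degree Q = 0")
    case True
    then obtain c where "Q = [:c:]"
      by (metis degree_eq_zeroE)
    then show ?thesis
      by (intro exI[of _ 1]) auto
  next
    case False
    have "filterlim (poly Q) at_infinity at_infinity"
      using False by (intro filterlim_poly_at_infinity) auto
    moreover have "norm (lead_coeff Q) / 2 > 0"
      using Q by simp
    ultimately obtain B where "\<And>z. norm z \<ge> B \<Longrightarrow> norm (poly Q z) \<ge> norm (lead_coeff Q) / 2"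
      unfolding filterlim_at_infinity[OF order_refl] eventually_at_infinity by blast
    then show ?thesis
      by (metis less_max_iff_disj max.bounded_iff zero_less_one)
  qed
  then obtain B where B: "B > 0"
    "\<And>z. norm z \<ge> B \<Longrightarrow> norm (poly Q z) \<ge> norm (lead_coeff Q) / 2"
    by blast
  have l: "norm (lead_coeff Q) / 2 > 0"
    using Q by simp
  have "compact (k ` cball 0 B)"
    using k(1) by (intro compact_continuous_image)
      (auto intro: holomorphic_on_imp_continuous_on continuous_on_subset)
  then have "bounded (k ` cball 0 B)"
    by (rule compact_imp_bounded)
  then obtain D where D': "\<forall>y \<in> k ` cball 0 B. norm y \<le> D"
    unfolding bounded_iff by (rule exE)
  have D: "norm (k z) \<le> D" if "norm z \<le> B" for z
    using bspec[OF D' imageI, of z] that by simp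
  define C' where "C' = max D (C / (norm (lead_coeff Q) / 2))"
  have "D \<ge> 0"
    using D[of 0] B(1) norm_ge_zero[of "k 0"] by (simp del: norm_ge_zero)
  have "norm (k z) \<le> C' * exp (K * sqrt (norm z))" for z
  proof (cases "norm z \<le> B")
    case True
    have "norm (k z) \<le> C' * 1"
      using D[OF True] by (simp add: C'_def)
    also have "\<dots> \<le> C' * exp (K * sqrt (norm z))"
      using K \<open>D \<ge> 0\<close> by (intro mult_left_mono) (auto simp: C'_def)
    finally show ?thesis .
  next
    case False
    then have "norm (lead_coeff Q) / 2 * norm (k z) \<le> norm (poly Q z) * norm (k z)"
      using B(2) by (intro mult_right_mono) auto
    also have "\<dots> \<le> C * exp (K * sqrt (norm z))"
      using bnd[of z] k(3) by (simp add: norm_mult)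
    finally have "norm (k z) \<le> C / (norm (lead_coeff Q) / 2) * exp (K * sqrt (norm z))"
      using l by (simp add: field_simps)
    also have "\<dots> \<le> C' * exp (K * sqrt (norm z))"
      by (intro mult_right_mono) (auto simp: C'_def)
    finally show ?thesis .
  qed
  then have "k z = k 0" for z
    using nonvanishing_entire_exp_sqrt_const k by blast
  then have "G z = poly (smult (k 0) Q) z" for z
    using k(3)[of z] by simp
  then show ?thesis
    using that by blast
qed

lemma poly_norm_bound:
  "\<exists>M n. \<forall>z::complex. norm (poly Q z) \<le> M * (1 + norm z) ^ n"
proof (induction Q)
  case 0
  then show ?case
    by (intro exI[of _ 0]) auto
next
  case (pCons a Q)
  then obtain M n where M: "\<And>z. norm (poly Q z) \<le> M * (1 + norm z) ^ n"
    by blast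
  have "norm (poly (pCons a Q) z) \<le> (norm a + M) * (1 + norm z) ^ Suc n" for z
  proof -
    have "norm (poly (pCons a Q) z) \<le> norm a + norm z * norm (poly Q z)"
      by (simp add: norm_triangle_le norm_mult)
    also have "norm z * norm (poly Q z) \<le> (1 + norm z) * (M * (1 + norm z) ^ n)"
      using M by (intro mult_mono) auto
    also have "norm a \<le> norm a * (1 + norm z) ^ Suc n"
      using one_le_power[of "1 + norm z" "Suc n"] mult_left_mono[of 1 _ "norm a"] by auto
    finally show ?thesis
      by (simp add: algebra_simps)
  qed
  then show ?case
    by blast
qed

text \<open>With finitely many zeros, \<open>F (csqrt w)\<close> would be a polynomial in w, so F
  would grow polynomially, whereas \<open>sinh r / r\<close> outgrows every power on the imaginary
  axis.\<close>

lemma even_entire_infinite_zeros: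
  assumes hol: "F holomorphic_on UNIV" and even: "\<And>z. F (- z) = F z"
    and bnd: "\<And>z. norm (F z) \<le> C * exp (K * norm z)" and K: "K \<ge> 0"
    and d: "d > 0"
    and grow: "\<forall>\<^sub>F r in at_top. norm (F (\<i> * complex_of_real r)) \<ge> d * (sinh r / r)"
  shows "infinite {z. F z = 0}"
proof
  assume fin: "finite {z. F z = 0}"
  define G where "G = (\<lambda>w. F (csqrt w))"
  have "{w. G w = 0} \<subseteq> (\<lambda>z. z\<^sup>2) ` {z. F z = 0}"
  proof
    fix w assume "w \<in> {w. G w = 0}"
    then show "w \<in> (\<lambda>z. z\<^sup>2) ` {z. F z = 0}"
      by (intro image_eqI[of _ _ "csqrt w"]) (auto simp: G_def)
  qed
  then have "finite {w. G w = 0}"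
    using fin finite_surj by blast
  moreover have "norm (G w) \<le> C * exp (K * sqrt (norm w))" for w
    using bnd[of "csqrt w"] by (simp add: G_def)
  moreover have "G holomorphic_on UNIV"
    unfolding G_def using hol even by (rule holomorphic_even_csqrt)
  ultimately obtain Q where Q: "\<And>z. G z = poly Q z"
    using entire_exp_sqrt_finite_zeros_imp_poly K by metis
  have F: "F z = poly Q (z\<^sup>2)" for z
  proof -
    have "csqrt (z\<^sup>2) = z \<or> csqrt (z\<^sup>2) = - z"
      using power2_csqrt[of "z\<^sup>2"] by (simp only: power2_eq_iff)
    then show ?thesis
      using even Q[of "z\<^sup>2"] by (auto simp: G_def)
  qed
  obtain M n where M: "\<And>z. norm (poly Q z) \<le> M * (1 + norm z) ^ n"
    using poly_norm_bound by blast
  have "\<forall>\<^sub>F r in at_top. d * (sinh r / r) / (1 + r\<^sup>2) ^ n \<le> M"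
    using grow
  proof eventually_elim
    case (elim r)
    have "norm (F (\<i> * complex_of_real r)) \<le> M * (1 + r\<^sup>2) ^ n"
      unfolding F by (rule order_trans[OF M]) (simp add: power_mult_distrib norm_mult norm_power)
    moreover have "(1 + r\<^sup>2) ^ n > 0"
      by (simp add: add_pos_nonneg)
    ultimately show ?case
      using elim by (subst pos_divide_le_eq) auto
  qed
  moreover have "filterlim (\<lambda>r. d * (sinh r / r) / (1 + r\<^sup>2) ^ n) at_top at_top"
    using d by real_asymp
  then have "\<forall>\<^sub>F r in at_top. d * (sinh r / r) / (1 + r\<^sup>2) ^ n > M"
    unfolding filterlim_at_top_dense by (rule spec)
  ultimately have "\<forall>\<^sub>F r::real in at_top. False"
    by eventually_elim auto
  then show False
    by simp
qed

section \<open>The reduced characteristic function\<close>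

text \<open>The value 1 at the removable singularity makes this entire, so that the spectral
  parameter 0 needs no separate treatment.\<close>

definition csinc :: "complex \<Rightarrow> complex"
  where "csinc z = (if z = 0 then 1 else sin z / z)"

lemma mult_csinc: "z * csinc z = sin z"
  by (simp add: csinc_def)

lemma csinc_minus [simp]: "csinc (- z) = csinc z"
  by (simp add: csinc_def)

lemma csinc_cnj: "csinc (cnj z) = cnj (csinc z)"
  by (simp add: csinc_def cnj_sin)

lemma cos_csinc_squared: "(cos z)\<^sup>2 + z\<^sup>2 * (csinc z)\<^sup>2 = 1"
  by (metis mult_csinc power_mult_distrib sin_cos_squared_add2)

lemma csinc_zero_imp_real:
  assumes "csinc z = 0"
  shows "cnj z = z"
proof -
  have "sin z = 0"
    using assms mult_csinc[of z] by simp
  then show ?thesis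
    by (auto simp: sin_eq_0)
qed

lemma cos_zero_imp_real:
  assumes "cos z = 0"
  shows "cnj z = z"
  using assms by (auto simp: cos_eq_0)

lemma holomorphic_csinc: "csinc holomorphic_on UNIV"
proof (rule pole_theorem_open_0[where g = sin and a = 0])
  have "(sin has_field_derivative cos 0) (at (0 :: complex))"
    by (rule DERIV_sin)
  then show "csinc 0 = deriv sin 0"
    by (simp add: csinc_def DERIV_imp_deriv)
qed (auto simp: csinc_def intro!: holomorphic_intros)

section \<open>Entire functions of exponential type\<close>

definition exp_type :: "(complex \<Rightarrow> complex) \<Rightarrow> bool"
  where "exp_type f \<longleftrightarrow> (\<exists>C K. C \<ge> 0 \<and> K \<ge> 0 \<and> (\<forall>z. norm (f z) \<le> C * exp (K * norm z)))"

lemma exp_type_const: "exp_type (\<lambda>z. c)"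
  unfolding exp_type_def by (rule exI[of _ "norm c"], rule exI[of _ 0]) auto

lemma exp_type_add:
  assumes "exp_type f" "exp_type g"
  shows "exp_type (\<lambda>z. f z + g z)"
proof -
  obtain C K where f: "C \<ge> 0" "K \<ge> 0" "\<And>z. norm (f z) \<le> C * exp (K * norm z)"
    using assms(1) unfolding exp_type_def by auto
  obtain D L where g: "D \<ge> 0" "L \<ge> 0" "\<And>z. norm (g z) \<le> D * exp (L * norm z)"
    using assms(2) unfolding exp_type_def by auto
  have "norm (f z + g z) \<le> (C + D) * exp ((K + L) * norm z)" for z
  proof -
    have "norm (f z + g z) \<le> C * exp (K * norm z) + D * exp (L * norm z)"
      using f(3)[of z] g(3)[of z] norm_triangle_ineq[of "f z" "g z"] by linarith
    also have "C * exp (K * norm z) \<le> C * exp ((K + L) * norm z)"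
      using f g by (intro mult_left_mono) (auto intro!: mult_right_mono)
    also have "D * exp (L * norm z) \<le> D * exp ((K + L) * norm z)"
      using f g by (intro mult_left_mono) (auto intro!: mult_right_mono)
    finally show ?thesis
      by (simp add: algebra_simps)
  qed
  then show ?thesis
    unfolding exp_type_def using f g by (intro exI[of _ "C + D"] exI[of _ "K + L"]) auto
qed

lemma exp_type_mult:
  assumes "exp_type f" "exp_type g"
  shows "exp_type (\<lambda>z. f z * g z)"
proof -
  obtain C K where f: "C \<ge> 0" "K \<ge> 0" "\<And>z. norm (f z) \<le> C * exp (K * norm z)"
    using assms(1) unfolding exp_type_def by auto
  obtain D L where g: "D \<ge> 0" "L \<ge> 0" "\<And>z. norm (g z) \<le> D * exp (L * norm z)"
    using assms(2) unfolding exp_type_def by auto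
  have "norm (f z * g z) \<le> (C * D) * exp ((K + L) * norm z)" for z
  proof -
    have "norm (f z * g z) \<le> (C * exp (K * norm z)) * (D * exp (L * norm z))"
      unfolding norm_mult using f g by (intro mult_mono) auto
    then show ?thesis
      by (simp add: algebra_simps exp_add)
  qed
  then show ?thesis
    unfolding exp_type_def using f g by (intro exI[of _ "C * D"] exI[of _ "K + L"]) auto
qed

lemma exp_type_power: "exp_type f \<Longrightarrow> exp_type (\<lambda>z. f z ^ n)"
  by (induction n) (auto intro: exp_type_const exp_type_mult)

lemma exp_type_sum: "(\<And>i. i \<in> I \<Longrightarrow> exp_type (f i)) \<Longrightarrow> exp_type (\<lambda>z. \<Sum>i\<in>I. f i z)"
  by (induction I rule: infinite_finite_induct) (auto intro: exp_type_const exp_type_add)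

lemma exp_type_ident: "exp_type (\<lambda>z. z)"
proof -
  have "norm z \<le> 1 * exp (1 * norm z)" for z :: complex
    using exp_ge_add_one_self[of "norm z"] by (simp del: exp_ge_add_one_self)
  then show ?thesis
    unfolding exp_type_def by (intro exI[of _ 1]) auto
qed

lemma exp_type_exp: "exp_type (\<lambda>z. exp (c * z))"
proof -
  have "norm (exp (c * z)) \<le> 1 * exp (norm c * norm z)" for z
    using complex_Re_le_cmod[of "c * z"] by (simp add: norm_mult)
  then show ?thesis
    unfolding exp_type_def by (intro exI[of _ 1] exI[of _ "norm c"]) auto
qed

lemma exp_type_cos: "exp_type cos"
proof -
  have "exp_type (\<lambda>z. 1/2 * exp (\<i> * z) + 1/2 * exp ((-\<i>) * z))"
    by (intro exp_type_add exp_type_mult exp_type_const exp_type_exp)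
  moreover have "(\<lambda>z. 1/2 * exp (\<i> * z) + 1/2 * exp ((-\<i>) * z)) = cos"
    by (simp add: fun_eq_iff cos_exp_eq)
  ultimately show ?thesis
    by simp
qed

text \<open>Outside the unit disc \<open>csinc\<close> is dominated by the sine, inside it by a
  constant through compactness.\<close>

lemma exp_type_csinc: "exp_type csinc"
proof -
  have "exp_type (\<lambda>z. 1/(2*\<i>) * exp (\<i> * z) + (-1/(2*\<i>)) * exp ((-\<i>) * z))"
    by (intro exp_type_add exp_type_mult exp_type_const exp_type_exp)
  moreover have "(\<lambda>z. 1/(2*\<i>) * exp (\<i> * z) + (-1/(2*\<i>)) * exp ((-\<i>) * z)) = sin"
    by (simp add: fun_eq_iff sin_exp_eq field_simps)
  ultimately have "exp_type sin"
    by simp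
  then obtain C K where C: "C \<ge> 0" "K \<ge> 0" "\<And>z::complex. norm (sin z) \<le> C * exp (K * norm z)"
    unfolding exp_type_def by blast
  have "compact (csinc ` cball 0 1)"
    using holomorphic_csinc by (intro compact_continuous_image)
      (auto intro: holomorphic_on_imp_continuous_on continuous_on_subset)
  then have "bounded (csinc ` cball 0 1)"
    by (rule compact_imp_bounded)
  then obtain D where "\<forall>y \<in> csinc ` cball 0 1. norm y \<le> D"
    unfolding bounded_iff by (rule exE)
  then have D: "norm (csinc z) \<le> D" if "norm z \<le> 1" for z
    using bspec[OF _ imageI, of csinc "cball 0 1" _ z] that by simp
  have D0: "D \<ge> 0"
    using D[of 0] by (simp add: csinc_def)
  have "norm (csinc z) \<le> (C + D) * exp (K * norm z)" for z
  proof (cases "norm z \<le> 1")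
    case True
    have "norm (csinc z) \<le> (C + D) * 1"
      using D[OF True] C by simp
    also have "\<dots> \<le> (C + D) * exp (K * norm z)"
      using C D0 by (intro mult_left_mono) auto
    finally show ?thesis .
  next
    case False
    then have "norm (csinc z) \<le> norm (z * csinc z)"
      using mult_right_mono[of 1 "norm z" "norm (csinc z)"] by (simp add: norm_mult)
    also have "\<dots> \<le> C * exp (K * norm z)"
      using C by (simp add: mult_csinc)
    also have "\<dots> \<le> (C + D) * exp (K * norm z)"
      using D0 by (intro mult_right_mono) auto
    finally show ?thesis .
  qed
  then show ?thesis
    unfolding exp_type_def using C D0 by (intro exI[of _ "C + D"] exI[of _ K]) auto
qed

text \<open>The homogenisation \<open>s ^ n * q (c / s)\<close> of a polynomial q of degree at most n.\<close>

definition hom_poly :: "complex poly \<Rightarrow> nat \<Rightarrow> complex \<Rightarrow> complex \<Rightarrow> complex"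
  where "hom_poly q n c s = (\<Sum>i\<le>n. coeff q i * c ^ i * s ^ (n - i))"

lemma hom_poly_eq:
  assumes "degree q \<le> n" "s \<noteq> 0"
  shows "hom_poly q n c s = s ^ n * poly q (c / s)"
proof -
  have "poly q (c / s) = (\<Sum>i\<le>n. coeff q i * (c / s) ^ i)"
    unfolding poly_altdef using assms(1)
    by (intro sum.mono_neutral_left) (auto simp: coeff_eq_0)
  also have "s ^ n * \<dots> = hom_poly q n c s"
    unfolding hom_poly_def sum_distrib_left using assms(2)
    by (intro sum.cong) (auto simp: power_divide power_diff field_simps)
  finally show ?thesis ..
qed

lemma hom_poly_0: "hom_poly q n c 0 = coeff q n * c ^ n"
proof -
  have "hom_poly q n c 0 = (\<Sum>i\<in>{n}. coeff q i * c ^ i * 0 ^ (n - i))"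
    unfolding hom_poly_def by (intro sum.mono_neutral_right) auto
  then show ?thesis
    by simp
qed

text \<open>For degrees at most n and \<open>csinc z\<close> nonzero this is
  \<open>csinc z ^ n * (poly R x - z\<^sup>2 * poly B x)\<close> at
  \<open>x = cos z / csinc z\<close>. Homogenising avoids the division and gives an entire function
  of z, even in z.\<close>

definition char_fun :: "complex poly \<Rightarrow> complex poly \<Rightarrow> nat \<Rightarrow> complex \<Rightarrow> complex"
  where "char_fun R B n z = hom_poly R n (cos z) (csinc z) - z\<^sup>2 * hom_poly B n (cos z) (csinc z)"

lemma holomorphic_char_fun: "char_fun R B n holomorphic_on UNIV"
  unfolding char_fun_def hom_poly_def
  by (intro holomorphic_intros holomorphic_csinc)

lemma exp_type_char_fun: "exp_type (char_fun R B n)"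
proof -
  have "exp_type (\<lambda>z. hom_poly q n (cos z) (csinc z))" for q
    unfolding hom_poly_def
    by (intro exp_type_sum exp_type_mult exp_type_const exp_type_power exp_type_cos exp_type_csinc)
  then have "exp_type (\<lambda>z. hom_poly R n (cos z) (csinc z) + (-1) * (z\<^sup>2 * hom_poly B n (cos z) (csinc z)))"
    by (intro exp_type_add exp_type_mult exp_type_const exp_type_power exp_type_ident)
  then show ?thesis
    by (simp add: char_fun_def[abs_def])
qed

section \<open>Behaviour on the imaginary axis\<close>

lemma cos_i_of_real: "cos (\<i> * complex_of_real r) = of_real (cosh r)"
  by (simp add: cosh_field_def exp_of_real flip: cosh_conv_cos of_real_minus)

lemma csinc_i_of_real: "r \<noteq> 0 \<Longrightarrow> csinc (\<i> * complex_of_real r) = of_real (sinh r / r)"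
proof -
  assume r: "r \<noteq> 0"
  have "complex_of_real (sinh r) = sinh (of_real r)"
    by (simp add: sinh_field_def exp_of_real flip: of_real_minus)
  then have "sin (\<i> * complex_of_real r) = \<i> * of_real (sinh r)"
    by (simp add: sinh_conv_sin)
  then show ?thesis
    using r by (simp add: csinc_def)
qed

text \<open>At \<open>z = \<i> * r\<close> the quotient \<open>cos z / csinc z\<close> is
  \<open>r * cosh r / sinh r\<close> and \<open>z\<^sup>2\<close> is \<open>- r\<^sup>2\<close>. The
  growth hypothesis therefore bounds the function below by \<open>d * (sinh r / r) ^ n\<close>,
  which is exponentially large because \<open>n \<ge> 1\<close>.\<close>

lemma char_fun_infinite_zeros:
  assumes deg: "degree R \<le> n" "degree B \<le> n" and n: "n \<ge> 1" and d: "d > 0"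
    and grow: "\<forall>\<^sub>F r in at_top. norm (poly R (of_real (r * cosh r / sinh r))
      + of_real (r\<^sup>2) * poly B (of_real (r * cosh r / sinh r))) \<ge> d"
  shows "infinite {z. char_fun R B n z = 0}"
proof -
  obtain C K where CK: "K \<ge> 0" "\<And>z. norm (char_fun R B n z) \<le> C * exp (K * norm z)"
    using exp_type_char_fun unfolding exp_type_def by blast
  show ?thesis
  proof (rule even_entire_infinite_zeros[OF holomorphic_char_fun _ CK(2,1) d])
    show "char_fun R B n (- z) = char_fun R B n z" for z
      by (simp add: char_fun_def)
    have "\<forall>\<^sub>F r::real in at_top. sinh r / r \<ge> 1"
      by real_asymp
    then show "\<forall>\<^sub>F r in at_top. norm (char_fun R B n (\<i> * complex_of_real r)) \<ge> d * (sinh r / r)"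
      using grow eventually_gt_at_top[of 0]
    proof eventually_elim
      case (elim r)
      define x where "x = r * cosh r / sinh r"
      define z where "z = \<i> * complex_of_real r"
      have s: "csinc z = of_real (sinh r / r)"
        using elim by (simp add: z_def csinc_i_of_real)
      have s0: "csinc z \<noteq> 0"
        using s elim by auto
      have x: "cos z / csinc z = of_real x"
        using elim unfolding s by (simp add: z_def x_def cos_i_of_real)
      have "char_fun R B n z = csinc z ^ n * (poly R x + of_real (r\<^sup>2) * poly B x)"
        unfolding char_fun_def hom_poly_eq[OF deg(1) s0] hom_poly_eq[OF deg(2) s0] x
        by (simp add: algebra_simps z_def power_mult_distrib)
      then have "norm (char_fun R B n z) = (sinh r / r) ^ n * norm (poly R x + of_real (r\<^sup>2) * poly B x)"
        using elim unfolding s by (simp add: norm_mult norm_power norm_divide)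
      moreover have "sinh r / r \<le> (sinh r / r) ^ n"
        using n elim by (intro self_le_power) auto
      ultimately show ?case
        using elim d mult_mono[of "sinh r / r" "(sinh r / r) ^ n" d "norm (poly R x + of_real (r\<^sup>2) * poly B x)"]
        by (simp add: z_def x_def mult.commute)
    qed
  qed
qed

text \<open>The instance \<open>R = [:-\<xi>, 1:]\<close>, \<open>B = 0\<close> of the preceding
  lemma. It supplies many z with a prescribed quotient, for use at a multiple root of p, where the
  secular equation holds for all of them.\<close>

lemma infinite_zeros_cos_csinc: "infinite {z. cos z = \<xi> * csinc z}"
proof -
  have "infinite {z. char_fun [:-\<xi>, 1:] 0 1 z = 0}"
  proof (rule char_fun_infinite_zeros[where d = 1])
    have "\<forall>\<^sub>F r::real in at_top. r * cosh r / sinh r \<ge> norm \<xi> + 1"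
      by real_asymp
    then show "\<forall>\<^sub>F r in at_top. norm (poly [:-\<xi>, 1:] (of_real (r * cosh r / sinh r))
      + of_real (r\<^sup>2) * poly 0 (of_real (r * cosh r / sinh r))) \<ge> 1"
    proof eventually_elim
      case (elim r)
      define x where "x = r * cosh r / sinh r"
      have "1 \<le> norm (complex_of_real x) - norm \<xi>"
        using elim norm_ge_zero[of \<xi>] unfolding x_def[symmetric] norm_of_real by linarith
      also have "\<dots> \<le> norm (of_real x - \<xi>)"
        by (rule norm_triangle_ineq2)
      finally show ?case
        by (simp add: x_def)
    qed
  qed auto
  moreover have "char_fun [:-\<xi>, 1:] 0 1 z = cos z - \<xi> * csinc z" for z
    by (simp add: char_fun_def hom_poly_def)
  ultimately show ?thesis
    by simp
qed

text \<open>A zero of the characteristic function with \<open>csinc z \<noteq> 0\<close> is determined up to sign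
  by the quotient \<open>x = cos z / csinc z\<close> once common factors of \<open>x p\<close> and \<open>p'\<close> are removed,
  so infinitely many zeros give infinitely many quotients.  What is left is the case
  in which the reduced characteristic function is a polynomial in \<open>z\<^sup>2\<close>.\<close>

lemma infinite_quotients:
  fixes p :: "complex poly"
  assumes N: "degree p = N" "N \<ge> 1" and monic: "lead_coeff p = 1"
    and not_quad: "\<And>c. smult (of_nat N) ([:0, 1:] * p) \<noteq> [:c, 0, 1:] * pderiv p"
  shows "infinite {x. \<exists>z. csinc z \<noteq> 0 \<and> x = cos z / csinc z \<and>
           of_nat N * x * poly p x = (x\<^sup>2 + z\<^sup>2) * poly (pderiv p) x}"
proof -
  have p': "pderiv p \<noteq> 0" "degree (pderiv p) = N - 1"
    using N by (auto simp: pderiv_eq_0_iff degree_pderiv)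
  have p0: "p \<noteq> 0"
    using monic by auto
  define g where "g = gcd ([:0, 1:] * p) (pderiv p)"
  have g0: "g \<noteq> 0"
    using p' by (simp add: g_def)
  then obtain A B where AB: "[:0, 1:] * p = A * g" "pderiv p = B * g" "coprime A B"
    using gcd_coprime_exists unfolding g_def by metis
  have A0: "A \<noteq> 0" and B0: "B \<noteq> 0"
    using AB p' p0 by auto
  have "degree ([:0, 1:] * p) = N + 1"
    using p0 N by (subst degree_mult_eq) auto
  then have "degree A + degree g = N + 1"
    unfolding AB(1) using A0 g0 by (simp add: degree_mult_eq)
  moreover have "degree B + degree g = N - 1"
    using p'(2) B0 g0 by (simp add: AB degree_mult_eq)
  ultimately have deg: "degree A = degree B + 2"
    using N by linarith
  \<comment> \<open>The reduced equation \<open>N A = (x\<^sup>2 + z\<^sup>2) B\<close> is rewritten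
    as \<open>R = z\<^sup>2 B\<close>, separating the dependence on x from that on z; n bounds both
    degrees.\<close>
  define R where "R = smult (of_nat N) A - [:0, 0, 1:] * B"
  define n where "n = max (degree R) (degree B)"
  \<comment> \<open>For \<open>n = 0\<close> both R and B are constants and their ratio is a value
    of c for which the excluded identity holds.\<close>
  have n: "n \<ge> 1"
  proof (rule ccontr)
    assume "\<not> n \<ge> 1"
    then have "degree R = 0" "degree B = 0"
      by (auto simp: n_def)
    then obtain \<beta> \<gamma> where b: "R = [:\<beta>:]" "B = [:\<gamma>:]"
      by (meson degree_eq_zeroE)
    have "\<gamma> \<noteq> 0"
      using B0 b by auto
    have "smult (of_nat N) ([:0, 1:] * p) = (R + [:0, 0, 1:] * B) * g"
      unfolding R_def AB(1) by (simp add: algebra_simps)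
    also have "R + [:0, 0, 1:] * B = [:\<beta> / \<gamma>, 0, 1:] * B"
      using \<open>\<gamma> \<noteq> 0\<close> by (simp add: b)
    also have "\<dots> * g = [:\<beta> / \<gamma>, 0, 1:] * pderiv p"
      by (simp only: AB(2) mult.assoc)
    finally show False
      using not_quad by blast
  qed
  have "infinite {z. char_fun R B n z = 0}"
  proof (rule char_fun_infinite_zeros[where d = "1/2"])
    \<comment> \<open>Along \<open>z = \<i> * r\<close>, \<open>X r\<close> is the quotient x and
      \<open>\<tau> r\<close> is \<open>x\<^sup>2 + z\<^sup>2\<close>, which tends to 0. The
      quantity to be bounded is \<open>A (N - \<tau> B / A)\<close>; since B has smaller degree than
      A, the bracket tends to \<open>N \<ge> 1\<close> while A tends to infinity. This leaves room
      for the bound 1/2.\<close>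
    define X where "X = (\<lambda>r::real. complex_of_real (r * cosh r / sinh r))"
    define \<tau> where "\<tau> = (\<lambda>r::real. (r * cosh r / sinh r)\<^sup>2 - r\<^sup>2)"
    have "filterlim (\<lambda>r::real. r * cosh r / sinh r) at_top at_top"
      by real_asymp
    then have X: "filterlim X at_infinity at_top"
      unfolding X_def filterlim_at_infinity_conv_norm_at_top norm_of_real
      by (rule filterlim_compose[OF filterlim_abs_real])
    have "(\<tau> \<longlongrightarrow> 0) at_top"
      unfolding \<tau>_def by real_asymp
    then have "((\<lambda>r. complex_of_real (\<tau> r)) \<longlongrightarrow> of_real 0) at_top"
      by (rule tendsto_of_real)
    moreover have "((\<lambda>r. poly B (X r) / poly A (X r)) \<longlongrightarrow> 0) at_top"
      by (rule filterlim_compose[OF poly_divide_tendsto_0_at_infinity X]) (simp add: deg)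
    ultimately have "((\<lambda>r. of_real (\<tau> r) * (poly B (X r) / poly A (X r))) \<longlongrightarrow> of_real 0 * 0) at_top"
      by (rule tendsto_mult)
    then have "\<forall>\<^sub>F r in at_top. norm (of_real (\<tau> r) * (poly B (X r) / poly A (X r))) < 1/2"
      using order_tendstoD(2)[OF tendsto_norm, of _ 0 at_top "1/2"] by simp
    moreover have "filterlim (\<lambda>r. poly A (X r)) at_infinity at_top"
      using X by (intro filterlim_compose[OF filterlim_poly_at_infinity]) (auto simp: deg)
    then have "\<forall>\<^sub>F r in at_top. norm (poly A (X r)) \<ge> 1"
      unfolding filterlim_at_infinity[OF order_refl] by (auto elim: allE[of _ 1])
    ultimately show "\<forall>\<^sub>F r in at_top. norm (poly R (of_real (r * cosh r / sinh r))
      + of_real (r\<^sup>2) * poly B (of_real (r * cosh r / sinh r))) \<ge> 1/2"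
    proof eventually_elim
      case (elim r)
      define a b where "a = poly A (X r)" and "b = poly B (X r)"
      have a: "a \<noteq> 0" "norm a \<ge> 1"
        using elim by (auto simp: a_def)
      have "poly R (X r) + of_real (r\<^sup>2) * b = of_nat N * a - of_real (\<tau> r) * b"
        by (simp add: R_def a_def b_def \<tau>_def X_def algebra_simps power2_eq_square)
      also have "\<dots> = a * (of_nat N - of_real (\<tau> r) * (b / a))"
        using a by (simp add: field_simps)
      finally have *: "poly R (X r) + of_real (r\<^sup>2) * b = a * (of_nat N - of_real (\<tau> r) * (b / a))" .
      have "1/2 \<le> real N - norm (of_real (\<tau> r) * (b / a))"
        using elim N(2) unfolding a_def[symmetric] b_def[symmetric] by linarith
      also have "\<dots> \<le> norm (of_nat N - of_real (\<tau> r) * (b / a))"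
        using norm_triangle_ineq2[of "of_nat N :: complex"] by simp
      finally have "1 * (1/2) \<le> norm a * norm (of_nat N - of_real (\<tau> r) * (b / a))"
        using a by (intro mult_mono) auto
      then show ?case
        using * by (simp add: norm_mult b_def X_def)
    qed
  qed (use n in \<open>auto simp: n_def\<close>)
  \<comment> \<open>Where \<open>csinc z = 0\<close> only the coefficients of index n survive and
    \<open>cos z\<close> is nonzero, which leaves an equation in \<open>z\<^sup>2\<close>. It is
    nontrivial because n is the larger of the two degrees and positive.\<close>
  moreover have "finite {z. char_fun R B n z = 0 \<and> csinc z = 0}"
  proof -
    have ne: "coeff R n \<noteq> 0 \<or> coeff B n \<noteq> 0"
      using n unfolding n_def by (cases "degree R \<le> degree B") (auto simp: max_def)
    then have "finite {z. poly [:coeff R n, 0, - coeff B n:] z = 0}"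
      by (intro poly_roots_finite) auto
    moreover have "poly [:coeff R n, 0, - coeff B n:] z = 0" if "char_fun R B n z = 0" "csinc z = 0" for z
    proof -
      have "cos z \<noteq> 0"
        using cos_csinc_squared[of z] that by auto
      then show ?thesis
        using that by (auto simp: char_fun_def hom_poly_0 power2_eq_square)
    qed
    ultimately show ?thesis
      by (elim finite_subset[rotated]) auto
  qed
  ultimately have inf: "infinite ({z. char_fun R B n z = 0} - {z. char_fun R B n z = 0 \<and> csinc z = 0})"
    by simp
  define Z where "Z = {z. char_fun R B n z = 0 \<and> csinc z \<noteq> 0}"
  have "{z. char_fun R B n z = 0} - {z. char_fun R B n z = 0 \<and> csinc z = 0} = Z"
    by (auto simp: Z_def)
  with inf have Zinf: "infinite Z"
    by simp
  define q where "q = (\<lambda>z. cos z / csinc z)"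
  have Z: "poly R (q z) = z\<^sup>2 * poly B (q z)" if "z \<in> Z" for z
    using that hom_poly_eq[of R n "csinc z" "cos z"] hom_poly_eq[of B n "csinc z" "cos z"]
    by (auto simp: Z_def char_fun_def n_def q_def)
  have "infinite (q ` Z)"
  proof
    assume "finite (q ` Z)"
    \<comment> \<open>All z sharing a quotient x satisfy
      \<open>poly R x = z\<^sup>2 * poly B x\<close>. Coprimality of A and B keeps the two values
      from vanishing together, so only finitely many z are possible.\<close>
    then obtain w where "infinite {z \<in> Z. q z = q w}"
      using pigeonhole_infinite[OF Zinf] by blast
    moreover have "poly R (q w) \<noteq> 0 \<or> poly B (q w) \<noteq> 0"
      using coprime_poly_0[OF AB(3), of "q w"] N by (auto simp: R_def)
    then have "finite {z. poly [:poly R (q w), 0, - poly B (q w):] z = 0}"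
      by (intro poly_roots_finite) auto
    moreover have "{z \<in> Z. q z = q w} \<subseteq> {z. poly [:poly R (q w), 0, - poly B (q w):] z = 0}"
    proof
      fix z assume "z \<in> {z \<in> Z. q z = q w}"
      then have "poly R (q w) = z\<^sup>2 * poly B (q w)"
        using Z[of z] by auto
      then show "z \<in> {z. poly [:poly R (q w), 0, - poly B (q w):] z = 0}"
        by (simp add: power2_eq_square)
    qed
    ultimately show False
      using finite_subset by blast
  qed
  moreover have "q ` Z \<subseteq> {x. \<exists>z. csinc z \<noteq> 0 \<and> x = cos z / csinc z \<and>
           of_nat N * x * poly p x = (x\<^sup>2 + z\<^sup>2) * poly (pderiv p) x}"
  proof
    fix x assume "x \<in> q ` Z"
    then obtain z where z: "z \<in> Z" "x = q z"
      by blast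
    have "of_nat N * poly A x = (x\<^sup>2 + z\<^sup>2) * poly B x"
      using Z[OF z(1)] by (simp add: R_def z(2) algebra_simps power2_eq_square)
    then have "of_nat N * (poly A x * poly g x) = (x\<^sup>2 + z\<^sup>2) * (poly B x * poly g x)"
      by (metis mult.assoc)
    moreover have "x * poly p x = poly A x * poly g x"
      using arg_cong[OF AB(1), of "\<lambda>q. poly q x"] by simp
    moreover have "poly (pderiv p) x = poly B x * poly g x"
      by (simp add: AB(2))
    ultimately show "x \<in> {x. \<exists>z. csinc z \<noteq> 0 \<and> x = cos z / csinc z \<and>
           of_nat N * x * poly p x = (x\<^sup>2 + z\<^sup>2) * poly (pderiv p) x}"
      using z by (auto simp: Z_def q_def mult.assoc intro!: exI[of _ z])
  qed
  ultimately show ?thesis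
    using finite_subset by blast
qed

section \<open>Solutions on an edge\<close>

text \<open>Fundamental solutions of \<open>u'' = - z\<^sup>2 u\<close>; \<open>sinz z x\<close> is \<open>sin (z x) / z\<close> with its limit value x at \<open>z = 0\<close>.\<close>

definition cosz :: "complex \<Rightarrow> real \<Rightarrow> complex"
  where "cosz z x = cos (z * of_real x)"

definition sinz :: "complex \<Rightarrow> real \<Rightarrow> complex"
  where "sinz z x = of_real x * csinc (z * of_real x)"

lemma cosz_sinz_simps [simp]:
  "cosz z 0 = 1" "sinz z 0 = 0" "cosz z 1 = cos z" "sinz z 1 = csinc z"
  by (simp_all add: cosz_def sinz_def)

lemma cosz_sinz_squared: "(cosz z x)\<^sup>2 + z\<^sup>2 * (sinz z x)\<^sup>2 = 1"
  using cos_csinc_squared[of "z * of_real x"]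
  by (simp add: cosz_def sinz_def power_mult_distrib mult.assoc)

lemma cosz_has_vector_derivative:
  "(cosz z has_vector_derivative - z\<^sup>2 * sinz z x) (at x within A)"
proof -
  have "((\<lambda>t. cos (z * of_real t)) has_vector_derivative z * (- sin (z * of_real x))) (at x within A)"
    by (rule has_vector_derivative_real_field) (auto intro!: derivative_eq_intros)
  moreover have "z * (- sin (z * of_real x)) = - z\<^sup>2 * sinz z x"
    by (simp add: sinz_def mult_csinc[symmetric] power2_eq_square)
  ultimately show ?thesis
    by (simp add: cosz_def[abs_def])
qed

lemma sinz_has_vector_derivative:
  "(sinz z has_vector_derivative cosz z x) (at x within A)"
proof (cases "z = 0")
  case True
  have "((\<lambda>t. of_real t) has_vector_derivative (1 :: complex)) (at x within A)"
    using has_vector_derivative_real_field[of "\<lambda>z. z" 1 x A] by simp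
  then show ?thesis
    using True by (simp add: sinz_def[abs_def] cosz_def csinc_def)
next
  case False
  have "((\<lambda>t. sin (z * of_real t) / z) has_vector_derivative cos (z * of_real x)) (at x within A)"
    by (rule has_vector_derivative_real_field) (use False in \<open>auto intro!: derivative_eq_intros\<close>)
  moreover have "sinz z = (\<lambda>t. sin (z * of_real t) / z)"
    using False mult_csinc[of "z * of_real t" for t] by (auto simp: fun_eq_iff sinz_def field_simps)
  ultimately show ?thesis
    by (simp add: cosz_def)
qed

lemmas cosz_sinz_deriv [derivative_intros] =
  has_vector_derivative_eq_rhs[OF cosz_has_vector_derivative]
  has_vector_derivative_eq_rhs[OF sinz_has_vector_derivative]

lemma continuous_on_cosz_sinz: "continuous_on A (cosz z)" "continuous_on A (sinz z)"
  using cosz_has_vector_derivative sinz_has_vector_derivative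
  by (auto intro!: continuous_on_vector_derivative)

text \<open>The functions a and b arise by applying the inverse of the fundamental matrix, whose
  determinant is 1, to the pair w, w'. They are constants of motion, and inverting once more
  expresses w and w' by the initial data.\<close>

lemma homogeneous_solution:
  fixes z :: complex
  assumes w: "\<And>x. x \<in> {0..1} \<Longrightarrow> (w has_vector_derivative w' x) (at x within {0..1})"
    and w': "\<And>x. x \<in> {0..1} \<Longrightarrow> (w' has_vector_derivative - z\<^sup>2 * w x) (at x within {0..1})"
    and x: "x \<in> {0..1}"
  shows "w x = w 0 * cosz z x + w' 0 * sinz z x"
    and "w' x = w' 0 * cosz z x - w 0 * z\<^sup>2 * sinz z x"
proof -
  define a where "a = (\<lambda>x. w x * cosz z x - w' x * sinz z x)"
  define b where "b = (\<lambda>x. z\<^sup>2 * (w x * sinz z x) + w' x * cosz z x)"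
  have "(a has_vector_derivative 0) (at x within {0..1})" if "x \<in> {0..1}" for x
    unfolding a_def using w[OF that] w'[OF that]
    by (auto intro!: derivative_eq_intros simp: algebra_simps)
  then obtain c where c: "\<And>x. x \<in> {0..1} \<Longrightarrow> a x = c"
    using has_vector_derivative_zero_constant[of "{0..1::real}" a] by auto
  have "(b has_vector_derivative 0) (at x within {0..1})" if "x \<in> {0..1}" for x
    unfolding b_def using w[OF that] w'[OF that]
    by (auto intro!: derivative_eq_intros simp: algebra_simps)
  then obtain d where d: "\<And>x. x \<in> {0..1} \<Longrightarrow> b x = d"
    using has_vector_derivative_zero_constant[of "{0..1::real}" b] by auto
  have a: "a x = w 0" and b: "b x = w' 0"
    using c[of 0] c[OF x] d[of 0] d[OF x] by (auto simp: a_def b_def)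
  have "w x = w x * ((cosz z x)\<^sup>2 + z\<^sup>2 * (sinz z x)\<^sup>2)"
    by (simp add: cosz_sinz_squared)
  also have "\<dots> = a x * cosz z x + b x * sinz z x"
    by (simp add: a_def b_def algebra_simps power2_eq_square)
  finally show "w x = w 0 * cosz z x + w' 0 * sinz z x"
    by (simp add: a b)
  have "w' x = w' x * ((cosz z x)\<^sup>2 + z\<^sup>2 * (sinz z x)\<^sup>2)"
    by (simp add: cosz_sinz_squared)
  also have "\<dots> = b x * cosz z x - a x * z\<^sup>2 * sinz z x"
    by (simp add: a_def b_def algebra_simps power2_eq_square)
  finally show "w' x = w' 0 * cosz z x - w 0 * z\<^sup>2 * sinz z x"
    by (simp add: a b)
qed

text \<open>Variation of constants: v is the integral of \<open>sinz z (x - t) * k t\<close>, with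
  the kernel split by the addition theorem into the two integrals I and J.\<close>

lemma particular_solution:
  fixes k :: "real \<Rightarrow> complex"
  assumes k: "continuous_on {0..1} k"
  obtains v v' where "v 0 = 0" "v' 0 = 0"
    "\<And>x. x \<in> {0..1} \<Longrightarrow> (v has_vector_derivative v' x) (at x within {0..1})"
    "\<And>x. x \<in> {0..1} \<Longrightarrow> (v' has_vector_derivative k x - z\<^sup>2 * v x) (at x within {0..1})"
proof -
  define I where "I = (\<lambda>x. integral {0..x} (\<lambda>t. cosz z t * k t))"
  define J where "J = (\<lambda>x. integral {0..x} (\<lambda>t. sinz z t * k t))"
  have I: "(I has_vector_derivative cosz z x * k x) (at x within {0..1})"
    and J: "(J has_vector_derivative sinz z x * k x) (at x within {0..1})" if "x \<in> {0..1}" for x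
    unfolding I_def J_def using that k
    by (auto intro!: integral_has_vector_derivative continuous_intros continuous_on_cosz_sinz)
  define v where "v = (\<lambda>x. sinz z x * I x - cosz z x * J x)"
  define v' where "v' = (\<lambda>x. cosz z x * I x + z\<^sup>2 * (sinz z x * J x))"
  have "(v has_vector_derivative v' x) (at x within {0..1})" if "x \<in> {0..1}" for x
    unfolding v_def v'_def using I[OF that] J[OF that]
    by (auto intro!: derivative_eq_intros simp: algebra_simps)
  moreover have "(v' has_vector_derivative k x - z\<^sup>2 * v x) (at x within {0..1})" if "x \<in> {0..1}" for x
  proof -
    have "k x = k x * ((cosz z x)\<^sup>2 + z\<^sup>2 * (sinz z x)\<^sup>2)"
      by (simp add: cosz_sinz_squared)
    then have "k x - z\<^sup>2 * v x = cosz z x * (cosz z x * k x) - z\<^sup>2 * sinz z x * I x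
        + z\<^sup>2 * (sinz z x * (sinz z x * k x) + cosz z x * J x)"
      by (simp add: v_def algebra_simps power2_eq_square)
    then show ?thesis
      unfolding v'_def using I[OF that] J[OF that]
      by (auto intro!: derivative_eq_intros)
  qed
  moreover have "v 0 = 0" "v' 0 = 0"
    by (auto simp: v_def v'_def I_def J_def)
  ultimately show ?thesis
    using that by blast
qed

section \<open>Square-integrable data and Sobolev solutions on an edge\<close>

lemma L2fun_continuous_on: "continuous_on {0..1} u \<Longrightarrow> L2fun u"
  unfolding L2fun_def
  by (auto intro!: absolutely_integrable_continuous_real integrable_continuous_real continuous_intros)

lemma L2fun_add:
  assumes f: "L2fun f" and g: "L2fun g"
  shows "L2fun (\<lambda>x. f x + g x)"
proof -
  have meas: "f \<in> borel_measurable (lebesgue_on {0..1})" "g \<in> borel_measurable (lebesgue_on {0..1})"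
    using f g by (auto simp: L2fun_def intro!: absolutely_integrable_imp_borel_measurable)
  have "(\<lambda>x. (cmod (f x + g x))\<^sup>2) integrable_on {0..1}"
  proof (rule measurable_bounded_by_integrable_imp_integrable)
    show "(\<lambda>x. (cmod (f x + g x))\<^sup>2) \<in> borel_measurable (lebesgue_on {0..1})"
      using meas by measurable
    show "(\<lambda>x. 2 * (cmod (f x))\<^sup>2 + 2 * (cmod (g x))\<^sup>2) integrable_on {0..1}"
      using f g by (intro integrable_add integrable_on_mult_right) (auto simp: L2fun_def)
    show "norm ((cmod (f x + g x))\<^sup>2) \<le> 2 * (cmod (f x))\<^sup>2 + 2 * (cmod (g x))\<^sup>2" for x
    proof -
      have "(cmod (f x + g x))\<^sup>2 \<le> (cmod (f x) + cmod (g x))\<^sup>2"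
        by (intro power_mono norm_triangle_ineq) auto
      also have "\<dots> \<le> 2 * (cmod (f x))\<^sup>2 + 2 * (cmod (g x))\<^sup>2"
        using sum_squares_bound[of "cmod (f x)" "cmod (g x)"] by (simp add: power2_sum)
      finally show ?thesis
        by simp
    qed
  qed auto
  moreover have "(\<lambda>x. f x + g x) absolutely_integrable_on {0..1}"
    using f g by (intro set_integral_add) (auto simp: L2fun_def)
  ultimately show ?thesis
    by (simp add: L2fun_def)
qed

lemma L2fun_uminus: "L2fun f \<Longrightarrow> L2fun (\<lambda>x. - f x)"
  unfolding L2fun_def
  using absolutely_integrable_linear[OF _ bounded_linear_minus[OF bounded_linear_ident]]
  by (auto simp: o_def)

lemma L2fun_integrable_on:
  assumes "L2fun f" "x \<in> {0..1}"
  shows "f integrable_on {0..x}"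
proof -
  have "f integrable_on {0..1}"
    using assms(1) set_lebesgue_integral_eq_integral(1) by (auto simp: L2fun_def)
  then show ?thesis
    using assms(2) by (elim integrable_subinterval_real) auto
qed

text \<open>Writing \<open>u = v - F2\<close> with \<open>F2\<close> a second antiderivative of f turns the equation into
  one with a continuous right-hand side, so that v is a classical solution.\<close>

lemma edge_solutions:
  assumes f: "L2fun f"
  obtains v v' where "v 0 = 0" "v' 0 = 0"
    "\<And>a b. W22 (\<lambda>x. a * cosz z x + b * sinz z x + v x)
        (\<lambda>x. b * cosz z x - a * z\<^sup>2 * sinz z x + v' x)
        (\<lambda>x. - f x - z\<^sup>2 * (a * cosz z x + b * sinz z x + v x))"
proof -
  define F1 where "F1 = (\<lambda>x. integral {0..x} f)"
  define F2 where "F2 = (\<lambda>x. integral {0..x} F1)"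
  have "continuous_on {0..1} F1"
    unfolding F1_def using L2fun_integrable_on[OF f, of 1] by (intro indefinite_integral_continuous_1) auto
  then have F2: "(F2 has_vector_derivative F1 x) (at x within {0..1})" if "x \<in> {0..1}" for x
    unfolding F2_def using that by (intro integral_has_vector_derivative)
  then have F2_cont: "continuous_on {0..1} F2"
    by (intro continuous_on_vector_derivative)
  then have "continuous_on {0..1} (\<lambda>x. z\<^sup>2 * F2 x)"
    by (intro continuous_intros)
  then obtain v v' where v: "v 0 = 0" "v' 0 = 0"
    "\<And>x. x \<in> {0..1} \<Longrightarrow> (v has_vector_derivative v' x) (at x within {0..1})"
    "\<And>x. x \<in> {0..1} \<Longrightarrow> (v' has_vector_derivative z\<^sup>2 * F2 x - z\<^sup>2 * v x) (at x within {0..1})"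
    by (rule particular_solution[where z = z]) blast
  show ?thesis
  proof (rule that)
    show "v 0 - F2 0 = 0" "v' 0 - F1 0 = 0"
      using v by (auto simp: F1_def F2_def)
    fix a b
    define u where "u = (\<lambda>x. a * cosz z x + b * sinz z x + (v x - F2 x))"
    \<comment> \<open>The derivative of u splits into the classically differentiable part
      \<open>w'\<close> and \<open>F1\<close>, which is only an indefinite integral of f.\<close>
    define w' where "w' = (\<lambda>x. b * cosz z x - a * z\<^sup>2 * sinz z x + v' x)"
    define u' where "u' = (\<lambda>x. w' x - F1 x)"
    have du: "(u has_vector_derivative u' x) (at x within {0..1})" if "x \<in> {0..1}" for x
      unfolding u_def u'_def w'_def using v(3)[OF that] F2[OF that]
      by (auto intro!: derivative_eq_intros simp: algebra_simps)
    have dw: "(w' has_vector_derivative - z\<^sup>2 * u x) (at x within {0..1})" if "x \<in> {0..1}" for x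
      unfolding u_def w'_def using v(4)[OF that]
      by (auto intro!: derivative_eq_intros simp: algebra_simps)
    have cu: "continuous_on {0..1} u"
      by (rule continuous_on_vector_derivative[OF du])
    have "continuous_on {0..1} w'"
      by (rule continuous_on_vector_derivative[OF dw])
    then have cu': "continuous_on {0..1} u'"
      unfolding u'_def using \<open>continuous_on {0..1} F1\<close> by (intro continuous_intros)
    have "L2fun (\<lambda>x. - f x + (- z\<^sup>2) * u x)"
      by (intro L2fun_add[OF L2fun_uminus[OF f] L2fun_continuous_on] continuous_intros cu)
    then have L: "L2fun (\<lambda>x. - f x - z\<^sup>2 * u x)"
      by simp
    have "u x = u 0 + integral {0..x} u' \<and> u' x = u' 0 + integral {0..x} (\<lambda>x. - f x - z\<^sup>2 * u x)"
      if x: "x \<in> {0..1}" for x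
    proof
      have sub: "{0..x} \<subseteq> {0..1}" "0 \<le> x"
        using x by auto
      have "(u' has_integral (u x - u 0)) {0..x}"
        using sub by (intro fundamental_theorem_of_calculus has_vector_derivative_within_subset[OF du]) auto
      then show "u x = u 0 + integral {0..x} u'"
        by (simp add: integral_unique)
      have "((\<lambda>x. - z\<^sup>2 * u x) has_integral (w' x - w' 0)) {0..x}"
        using sub by (intro fundamental_theorem_of_calculus has_vector_derivative_within_subset[OF dw]) auto
      moreover have "(f has_integral F1 x) {0..x}"
        unfolding F1_def using L2fun_integrable_on[OF f x] by (rule integrable_integral)
      ultimately have "((\<lambda>x. - z\<^sup>2 * u x - f x) has_integral (w' x - w' 0 - F1 x)) {0..x}"
        by (rule has_integral_diff)
      moreover have "(\<lambda>x. - z\<^sup>2 * u x - f x) = (\<lambda>x. - f x - z\<^sup>2 * u x)"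
        by auto
      ultimately have "integral {0..x} (\<lambda>x. - f x - z\<^sup>2 * u x) = w' x - w' 0 - F1 x"
        by (simp only: integral_unique)
      then show "u' x = u' 0 + integral {0..x} (\<lambda>x. - f x - z\<^sup>2 * u x)"
        by (simp add: u'_def F1_def)
    qed
    then have "W22 u u' (\<lambda>x. - f x - z\<^sup>2 * u x)"
      using cu' L unfolding W22_def by blast
    then show "W22 (\<lambda>x. a * cosz z x + b * sinz z x + (v x - F2 x))
        (\<lambda>x. b * cosz z x - a * z\<^sup>2 * sinz z x + (v' x - F1 x))
        (\<lambda>x. - f x - z\<^sup>2 * (a * cosz z x + b * sinz z x + (v x - F2 x)))"
      by (simp add: u_def u'_def w'_def algebra_simps)
  qed
qed

lemma edge_homogeneous:
  "W22 (\<lambda>x. a * cosz z x + b * sinz z x) (\<lambda>x. b * cosz z x - a * z\<^sup>2 * sinz z x)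
     (\<lambda>x. - z\<^sup>2 * (a * cosz z x + b * sinz z x))"
proof -
  define u where "u = (\<lambda>x. a * cosz z x + b * sinz z x)"
  define u' where "u' = (\<lambda>x. b * cosz z x - a * z\<^sup>2 * sinz z x)"
  have du: "(u has_vector_derivative u' x) (at x within A)" for x A
    unfolding u_def u'_def by (auto intro!: derivative_eq_intros simp: algebra_simps)
  have du': "(u' has_vector_derivative - z\<^sup>2 * u x) (at x within A)" for x A
    unfolding u_def u'_def by (auto intro!: derivative_eq_intros simp: algebra_simps)
  have c: "continuous_on {0..1} u" "continuous_on {0..1} u'"
    by (auto intro!: continuous_on_vector_derivative du du')
  have "u x = u 0 + integral {0..x} u' \<and> u' x = u' 0 + integral {0..x} (\<lambda>x. - z\<^sup>2 * u x)"
    if "x \<in> {0..1}" for x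
    using that integral_unique[OF fundamental_theorem_of_calculus[OF _ du, of 0 x]]
      integral_unique[OF fundamental_theorem_of_calculus[OF _ du', of 0 x]]
    by simp
  then have "W22 u u' (\<lambda>x. - z\<^sup>2 * u x)"
    unfolding W22_def using c L2fun_continuous_on[OF continuous_on_mult_left[OF c(1), of "- z\<^sup>2"]] by blast
  then show ?thesis
    by (simp add: u_def u'_def)
qed

text \<open>The second derivative of the difference w equals \<open>- z\<^sup>2 * w\<close> almost
  everywhere. This is continuous, so the integral equations make w a classical solution.\<close>

lemma edge_unique:
  assumes 1: "W22 u1 u1' g1" and 2: "W22 u2 u2' g2"
    and eq1: "AE x in lborel. x \<in> {0..1} \<longrightarrow> - g1 x - z\<^sup>2 * u1 x = f x"
    and eq2: "AE x in lborel. x \<in> {0..1} \<longrightarrow> - g2 x - z\<^sup>2 * u2 x = f x"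
    and x: "x \<in> {0..1}"
  shows "u1 x - u2 x = (u1 0 - u2 0) * cosz z x + (u1' 0 - u2' 0) * sinz z x"
    and "u1' x - u2' x = (u1' 0 - u2' 0) * cosz z x - (u1 0 - u2 0) * z\<^sup>2 * sinz z x"
proof -
  define w where "w = (\<lambda>x. u1 x - u2 x)"
  define w' where "w' = (\<lambda>x. u1' x - u2' x)"
  have cw': "continuous_on {0..1} w'"
    unfolding w'_def using 1 2 by (intro continuous_intros) (auto simp: W22_def)
  have w: "w x = w 0 + integral {0..x} w'" if "x \<in> {0..1}" for x
  proof -
    have "u1' integrable_on {0..x}" "u2' integrable_on {0..x}"
      using 1 2 that by (auto simp: W22_def intro!: integrable_continuous_real intro: continuous_on_subset)
    then have "integral {0..x} w' = integral {0..x} u1' - integral {0..x} u2'"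
      unfolding w'_def by (rule integral_diff)
    moreover have "u1 x = u1 0 + integral {0..x} u1'" "u2 x = u2 0 + integral {0..x} u2'"
      using 1 2 that unfolding W22_def by blast+
    ultimately show ?thesis
      by (simp add: w_def)
  qed
  have dw: "(w has_vector_derivative w' x) (at x within {0..1})" if "x \<in> {0..1}" for x
  proof (rule has_vector_derivative_transform[OF that])
    show "((\<lambda>x. w 0 + integral {0..x} w') has_vector_derivative w' x) (at x within {0..1})"
      using integral_has_vector_derivative[OF cw' that] by (auto intro!: derivative_eq_intros)
  qed (rule w)
  have cw: "continuous_on {0..1} w"
    by (rule continuous_on_vector_derivative[OF dw])
  have "AE x in lborel. x \<in> {0..1} \<longrightarrow> g1 x - g2 x = - z\<^sup>2 * w x"
    using eq1 eq2
  proof eventually_elim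
    case (elim x)
    show ?case
    proof
      assume "x \<in> {0..1}"
      then have "- g1 x - z\<^sup>2 * u1 x = - g2 x - z\<^sup>2 * u2 x"
        using elim by simp
      then show "g1 x - g2 x = - z\<^sup>2 * w x"
        by (simp add: w_def algebra_simps)
    qed
  qed
  \<comment> \<open>The exceptional set must become a negligible set, because the integrals in
    \<open>W22\<close> are gauge integrals.\<close>
  then have "AE x in lebesgue. x \<in> {0..1} \<longrightarrow> g1 x - g2 x = - z\<^sup>2 * w x"
    by (rule AE_completion)
  then obtain S where S: "{x \<in> space lebesgue. \<not> (x \<in> {0..1} \<longrightarrow> g1 x - g2 x = - z\<^sup>2 * w x)} \<subseteq> S"
    "emeasure lebesgue S = 0" "S \<in> sets lebesgue"
    by (rule AE_E)
  then have neg: "negligible S"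
    unfolding negligible_iff_null_sets by (intro null_setsI)
  have w': "w' x = w' 0 + integral {0..x} (\<lambda>x. - z\<^sup>2 * w x)" if "x \<in> {0..1}" for x
  proof -
    have "g1 integrable_on {0..x}" "g2 integrable_on {0..x}"
      using 1 2 that by (auto simp: W22_def intro!: L2fun_integrable_on)
    then have "integral {0..x} (\<lambda>x. g1 x - g2 x) = integral {0..x} g1 - integral {0..x} g2"
      by (rule integral_diff)
    moreover have "integral {0..x} (\<lambda>x. g1 x - g2 x) = integral {0..x} (\<lambda>x. - z\<^sup>2 * w x)"
      using S(1) that by (intro integral_spike[OF neg]) auto
    moreover have "u1' x = u1' 0 + integral {0..x} g1" "u2' x = u2' 0 + integral {0..x} g2"
      using 1 2 that unfolding W22_def by blast+
    ultimately show ?thesis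
      by (simp add: w'_def)
  qed
  have dw': "(w' has_vector_derivative - z\<^sup>2 * w x) (at x within {0..1})" if "x \<in> {0..1}" for x
  proof (rule has_vector_derivative_transform[OF that])
    have c: "continuous_on {0..1} (\<lambda>x. - z\<^sup>2 * w x)"
      using cw by (intro continuous_intros)
    show "((\<lambda>x. w' 0 + integral {0..x} (\<lambda>x. - z\<^sup>2 * w x)) has_vector_derivative - z\<^sup>2 * w x) (at x within {0..1})"
      using has_vector_derivative_add[OF has_vector_derivative_const integral_has_vector_derivative[OF c that]]
      by (simp only: add_0)
  qed (rule w')
  show "u1 x - u2 x = (u1 0 - u2 0) * cosz z x + (u1' 0 - u2' 0) * sinz z x"
    and "u1' x - u2' x = (u1' 0 - u2' 0) * cosz z x - (u1 0 - u2 0) * z\<^sup>2 * sinz z x"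
    using homogeneous_solution[OF dw dw' x] by (simp_all add: w_def w'_def)
qed

section \<open>The vertex conditions\<close>

text \<open>Determinant of the linear system \<open>a j * y j = K\<close>,
  \<open>(\<Sum>j<N. a j * w j) = 0\<close> in the unknowns a and K: equal values at the centre and
  vanishing sum of derivatives. The expanded form admits zeros among the \<open>y j\<close>.\<close>

definition star_det :: "nat \<Rightarrow> (nat \<Rightarrow> complex) \<Rightarrow> (nat \<Rightarrow> complex) \<Rightarrow> complex"
  where "star_det N y w = (\<Sum>j<N. w j * (\<Prod>k\<in>{..<N} - {j}. y k))"

lemma star_det_nonzero:
  assumes "\<And>j. j < N \<Longrightarrow> y j \<noteq> 0"
  shows "star_det N y w = (\<Prod>k<N. y k) * (\<Sum>j<N. w j / y j)"
  unfolding star_det_def sum_distrib_left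
proof (rule sum.cong[OF refl])
  fix j assume "j \<in> {..<N}"
  then have "(\<Prod>k<N. y k) = y j * (\<Prod>k\<in>{..<N} - {j}. y k)" "y j \<noteq> 0"
    using assms by (auto simp: prod.remove)
  then show "w j * (\<Prod>k\<in>{..<N} - {j}. y k) = (\<Prod>k<N. y k) * (w j / y j)"
    by simp
qed

lemma star_det_zero:
  assumes m: "m < N" "y m = 0"
  shows "star_det N y w = w m * (\<Prod>k\<in>{..<N} - {m}. y k)"
proof -
  have "(\<Prod>k\<in>{..<N} - {j}. y k) = 0" if "j \<noteq> m" for j
    using m that by (intro prod_zero) auto
  then have "star_det N y w = (\<Sum>j\<in>{m}. w j * (\<Prod>k\<in>{..<N} - {j}. y k))"
    unfolding star_det_def using m by (intro sum.mono_neutral_right) auto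
  then show ?thesis
    by simp
qed

text \<open>If no \<open>y j\<close> vanishes, each \<open>a j\<close> is a function of K and the
  sum condition fixes K. If \<open>y m = 0\<close>, then K must be \<open>b m\<close>; the nonzero
  determinant forces \<open>w m\<close> and all other \<open>y k\<close> to be nonzero, so the sum
  condition can be solved for \<open>a m\<close>.\<close>

lemma star_system_solvable:
  assumes det: "star_det N y w \<noteq> 0"
  obtains a K where "\<And>j. j < N \<Longrightarrow> a j * y j + b j = K" "(\<Sum>j<N. a j * w j + d j) = 0"
proof (cases "\<forall>j<N. y j \<noteq> 0")
  case True
  then have "(\<Sum>j<N. w j / y j) \<noteq> 0"
    using det star_det_nonzero[of N y w] by auto
  define K where "K = ((\<Sum>j<N. b j * w j / y j) - (\<Sum>j<N. d j)) / (\<Sum>j<N. w j / y j)"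
  define a where "a = (\<lambda>j. (K - b j) / y j)"
  have "a j * y j + b j = K" if "j < N" for j
    using True that by (simp add: a_def)
  moreover have "(\<Sum>j<N. a j * w j + d j) = K * (\<Sum>j<N. w j / y j) - (\<Sum>j<N. b j * w j / y j) + (\<Sum>j<N. d j)"
    unfolding sum_distrib_left by (simp add: a_def sum.distrib sum_subtractf diff_divide_distrib algebra_simps)
  then have "(\<Sum>j<N. a j * w j + d j) = 0"
    using \<open>(\<Sum>j<N. w j / y j) \<noteq> 0\<close> by (simp add: K_def)
  ultimately show ?thesis
    using that by blast
next
  case False
  then obtain m where m: "m < N" "y m = 0"
    by auto
  have wm: "w m \<noteq> 0" and y: "\<And>k. k < N \<Longrightarrow> k \<noteq> m \<Longrightarrow> y k \<noteq> 0"
    using det star_det_zero[of m N y w, OF m] by (auto simp: prod_zero_iff)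
  define a' where "a' = (\<lambda>j. (b m - b j) / y j)"
  define t where "t = - (d m + (\<Sum>j\<in>{..<N} - {m}. a' j * w j + d j)) / w m"
  define a where "a = a'(m := t)"
  have "a j * y j + b j = b m" if "j < N" for j
    using that y[of j] m by (auto simp: a_def a'_def)
  moreover have "(\<Sum>j<N. a j * w j + d j) = a m * w m + d m + (\<Sum>j\<in>{..<N} - {m}. a j * w j + d j)"
    using m by (subst sum.remove[of _ m]) auto
  moreover have "(\<Sum>j\<in>{..<N} - {m}. a j * w j + d j) = (\<Sum>j\<in>{..<N} - {m}. a' j * w j + d j)"
    by (intro sum.cong) (auto simp: a_def)
  ultimately show ?thesis
    using that[of a "b m"] wm by (simp add: a_def t_def)
qed

lemma star_system_unique:
  assumes det: "star_det N y w \<noteq> 0"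
    and a: "\<And>j. j < N \<Longrightarrow> a j * y j = K" "(\<Sum>j<N. a j * w j) = 0" and j: "j < N"
  shows "a j = 0"
proof (cases "\<forall>j<N. y j \<noteq> 0")
  case True
  then have "(\<Sum>j<N. w j / y j) \<noteq> 0"
    using det star_det_nonzero[of N y w] by auto
  moreover have "a j = K / y j" if "j < N" for j
    using True a(1)[OF that] that by (simp add: field_simps)
  then have "K * (\<Sum>j<N. w j / y j) = (\<Sum>j<N. a j * w j)"
    unfolding sum_distrib_left by (intro sum.cong) auto
  ultimately have "K = 0"
    using a(2) by simp
  then show ?thesis
    using True a(1) j by fastforce
next
  case False
  then obtain m where m: "m < N" "y m = 0"
    by auto
  have wm: "w m \<noteq> 0" and y: "\<And>k. k < N \<Longrightarrow> k \<noteq> m \<Longrightarrow> y k \<noteq> 0"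
    using det star_det_zero[of m N y w, OF m] by (auto simp: prod_zero_iff)
  have "K = 0"
    using a(1)[of m] m by simp
  then have a0: "a k = 0" if "k < N" "k \<noteq> m" for k
    using a(1)[of k] y[of k] that by simp
  have "(\<Sum>j<N. a j * w j) = a m * w m + (\<Sum>j\<in>{..<N} - {m}. a j * w j)"
    using m by (subst sum.remove[of _ m]) auto
  also have "(\<Sum>j\<in>{..<N} - {m}. a j * w j) = 0"
    using a0 by (intro sum.neutral) auto
  finally have "a m = 0"
    using a(2) wm by simp
  then show ?thesis
    using a0 j by metis
qed

text \<open>The kernel vector depends on the zeros among the y: without zeros take
  \<open>1 / y j\<close> and \<open>K = 1\<close>; with \<open>y m = w m = 0\<close> the unit vector
  at m; with two zeros m and k a vector on these two edges balancing \<open>w m\<close> against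
  \<open>w k\<close>.\<close>

lemma star_system_kernel:
  assumes N: "N \<ge> 1" and det: "star_det N y w = 0"
  obtains a K j where "\<And>j. j < N \<Longrightarrow> a j * y j = K" "(\<Sum>j<N. a j * w j) = 0" "j < N" "a j \<noteq> 0"
proof (cases "\<forall>j<N. y j \<noteq> 0")
  case True
  then have "(\<Prod>k<N. y k) \<noteq> 0"
    by (auto simp: prod_zero_iff)
  then have "(\<Sum>j<N. w j / y j) = 0"
    using det star_det_nonzero[of N y w] True by auto
  then show ?thesis
    using True N by (intro that[of "\<lambda>j. 1 / y j" 1 0]) auto
next
  case False
  then obtain m where m: "m < N" "y m = 0"
    by auto
  show ?thesis
  proof (cases "w m = 0")
    case True
    have "(\<Sum>j<N. (if j = m then 1 else 0) * w j) = 0"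
      using True by (intro sum.neutral) auto
    then show ?thesis
      using m by (intro that[of "\<lambda>j. if j = m then 1 else 0" 0 m]) auto
  next
    case False
    then have "(\<Prod>k\<in>{..<N} - {m}. y k) = 0"
      using det star_det_zero[of m N y w, OF m] by simp
    then obtain k where k: "k < N" "k \<noteq> m" "y k = 0"
      by (auto simp: prod_zero_iff)
    define a where "a = (\<lambda>j. if j = m then w k else if j = k then - w m else 0)"
    have "(\<Sum>j<N. a j * w j) = (\<Sum>j\<in>{m, k}. a j * w j)"
      using m k by (intro sum.mono_neutral_right) (auto simp: a_def)
    also have "\<dots> = 0"
      using k by (simp add: a_def)
    finally show ?thesis
      using m k False by (intro that[of a 0 k]) (auto simp: a_def)
  qed
qed

definition secular :: "nat \<Rightarrow> (nat \<Rightarrow> complex) \<Rightarrow> complex \<Rightarrow> complex"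
  where "secular N h z = star_det N (\<lambda>j. cos z + h j * csinc z) (\<lambda>j. h j * cos z - z\<^sup>2 * csinc z)"

text \<open>A kernel vector yields an eigenfunction. The multiples by \<open>c = 1\<close> and
  \<open>c = 0\<close> are two different solutions for the right-hand side 0, violating the
  uniqueness clause of the resolvent set.\<close>

lemma secular_zero_imp_spectrum:
  assumes N: "N \<ge> 1" and zero: "secular N h z = 0"
  shows "z\<^sup>2 \<in> star_spectrum N h"
proof -
  obtain a K m where a: "\<And>j. j < N \<Longrightarrow> a j * (cos z + h j * csinc z) = K"
      "(\<Sum>j<N. a j * (h j * cos z - z\<^sup>2 * csinc z)) = 0" "m < N" "a m \<noteq> 0"
    by (rule star_system_kernel[OF N zero[unfolded secular_def]]) blast
  define u where "u = (\<lambda>c j x. (c * a j) * cosz z x + (c * a j * h j) * sinz z x)"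
  define u' where "u' = (\<lambda>c j x. (c * a j * h j) * cosz z x - (c * a j) * z\<^sup>2 * sinz z x)"
  define g where "g = (\<lambda>c j x. - z\<^sup>2 * u c j x)"
  have "star_dom N h (u c) (u' c) (g c)" for c
  proof -
    have "u c j 1 = c * K" if "j < N" for j
      unfolding a(1)[OF that, symmetric] by (simp add: u_def algebra_simps)
    moreover have "(\<Sum>j<N. u' c j 1) = c * (\<Sum>j<N. a j * (h j * cos z - z\<^sup>2 * csinc z))"
      unfolding sum_distrib_left by (simp add: u'_def algebra_simps)
    moreover have "W22 (u c j) (u' c j) (g c j)" for j
      unfolding u_def u'_def g_def by (rule edge_homogeneous)
    moreover have "u' c j 0 = h j * u c j 0" for j
      by (simp add: u_def u'_def)
    ultimately show ?thesis
      by (simp add: star_dom_def a(2))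
  qed
  moreover have "star_eq N (z\<^sup>2) (u c) (g c) (\<lambda>j x. 0)" for c
    by (simp add: star_eq_def g_def)
  moreover have L: "L2fun (\<lambda>x. 0)"
    by (intro L2fun_continuous_on continuous_intros)
  ultimately have "\<forall>j<N. \<forall>x\<in>{0..1}. u 1 j x = u 0 j x" if "z\<^sup>2 \<in> star_resolvent N h"
    using that[unfolded star_resolvent_def mem_Collect_eq, rule_format, of "\<lambda>j x. 0"] by blast
  moreover have "u 1 m 0 \<noteq> u 0 m 0"
    using a(4) by (simp add: u_def)
  ultimately show ?thesis
    using a(3) by (fastforce simp: star_spectrum_def)
qed

text \<open>On each edge the Robin condition leaves one free coefficient \<open>a j\<close>; the
  vertex conditions are then a linear system with nonzero determinant. Differences of two solutions
  satisfy its homogeneous version.\<close>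

lemma secular_nonzero_imp_resolvent:
  assumes nz: "secular N h z \<noteq> 0"
  shows "z\<^sup>2 \<in> star_resolvent N h"
proof -
  define y where "y = (\<lambda>j. cos z + h j * csinc z)"
  define w where "w = (\<lambda>j. h j * cos z - z\<^sup>2 * csinc z)"
  have det: "star_det N y w \<noteq> 0"
    using nz by (simp add: secular_def y_def w_def)
  have ex: "\<exists>u u' g. star_dom N h u u' g \<and> star_eq N (z\<^sup>2) u g f" if f: "\<forall>j<N. L2fun (f j)" for f
  proof -
    define P where "P = (\<lambda>j v v'. v 0 = 0 \<and> v' 0 = 0 \<and>
      (\<forall>a b. W22 (\<lambda>x. a * cosz z x + b * sinz z x + v x)
        (\<lambda>x. b * cosz z x - a * z\<^sup>2 * sinz z x + v' x)
        (\<lambda>x. - f j x - z\<^sup>2 * (a * cosz z x + b * sinz z x + v x))))"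
    have "\<exists>v v'. P j v v'" if "j < N" for j
    proof -
      have "L2fun (f j)"
        using f that by blast
      then show ?thesis
        unfolding P_def by (rule edge_solutions[where z = z]) blast
    qed
    then obtain v v' where P: "\<And>j. j < N \<Longrightarrow> P j (v j) (v' j)"
      by metis
    note v = P[unfolded P_def]
    obtain a K where a: "\<And>j. j < N \<Longrightarrow> a j * y j + v j 1 = K" "(\<Sum>j<N. a j * w j + v' j 1) = 0"
      by (rule star_system_solvable[OF det, where b = "\<lambda>j. v j 1" and d = "\<lambda>j. v' j 1"]) blast
    define u where "u = (\<lambda>j x. a j * cosz z x + a j * h j * sinz z x + v j x)"
    define u' where "u' = (\<lambda>j x. a j * h j * cosz z x - a j * z\<^sup>2 * sinz z x + v' j x)"
    define g where "g = (\<lambda>j x. - f j x - z\<^sup>2 * u j x)"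
    have "u j 1 = K" if "j < N" for j
      unfolding a(1)[OF that, symmetric] by (simp add: u_def y_def algebra_simps)
    moreover have "(\<Sum>j<N. u' j 1) = 0"
      unfolding a(2)[symmetric] by (simp add: u'_def w_def algebra_simps)
    moreover have "W22 (u j) (u' j) (g j)" if "j < N" for j
      unfolding u_def u'_def g_def using v[OF that] by blast
    moreover have "u' j 0 = h j * u j 0" if "j < N" for j
      using v[OF that] by (simp add: u_def u'_def)
    ultimately have "star_dom N h u u' g"
      by (simp add: star_dom_def)
    moreover have "star_eq N (z\<^sup>2) u g f"
      by (simp add: star_eq_def g_def)
    ultimately show ?thesis
      by blast
  qed
  have un: "u1 j x = u2 j x"
    if 1: "star_dom N h u1 u1' g1" "star_eq N (z\<^sup>2) u1 g1 f"
      and 2: "star_dom N h u2 u2' g2" "star_eq N (z\<^sup>2) u2 g2 f"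
      and jx: "j < N" "x \<in> {0..1}" for f u1 u1' g1 u2 u2' g2 j x
  proof -
    define a where "a = (\<lambda>j. u1 j 0 - u2 j 0)"
    have a': "u1' j 0 - u2' j 0 = a j * h j" if "j < N" for j
      using 1(1) 2(1) that by (simp add: star_dom_def a_def algebra_simps)
    have eq: "u1 j x - u2 j x = a j * cosz z x + a j * h j * sinz z x"
        "u1' j x - u2' j x = a j * h j * cosz z x - a j * z\<^sup>2 * sinz z x"
      if "j < N" "x \<in> {0..1}" for j x
      using edge_unique[of "u1 j" "u1' j" "g1 j" "u2 j" "u2' j" "g2 j" z "f j" x] 1 2 that a'[OF that(1)]
      by (auto simp: star_dom_def star_eq_def a_def)
    have "a j * y j = u1 0 1 - u2 0 1" if "j < N" for j
    proof -
      have "0 < N"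
        using that by simp
      then have "u1 j 1 = u1 0 1" "u2 j 1 = u2 0 1"
        using 1(1) 2(1) that unfolding star_dom_def by blast+
      then show ?thesis
        using eq(1)[OF that, of 1] by (simp add: y_def algebra_simps)
    qed
    moreover have "(\<Sum>j<N. a j * w j) = (\<Sum>j<N. u1' j 1 - u2' j 1)"
      using eq(2)[of _ 1] by (intro sum.cong) (simp_all add: w_def algebra_simps)
    then have "(\<Sum>j<N. a j * w j) = 0"
      using 1(1) 2(1) by (simp add: star_dom_def sum_subtractf)
    ultimately have "a j = 0"
      using star_system_unique[OF det] jx(1) by blast
    then show ?thesis
      using eq(1)[OF jx] by simp
  qed
  show ?thesis
    unfolding star_resolvent_def mem_Collect_eq using ex un by blast
qed

lemma star_spectrum_iff_secular:
  assumes "N \<ge> 1"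
  shows "z\<^sup>2 \<in> star_spectrum N h \<longleftrightarrow> secular N h z = 0"
  using secular_zero_imp_spectrum[OF assms, of h z] secular_nonzero_imp_resolvent[of N h z]
  by (auto simp: star_spectrum_def)

section \<open>Symmetry of the spectrum\<close>

definition root_poly :: "nat \<Rightarrow> (nat \<Rightarrow> complex) \<Rightarrow> complex poly"
  where "root_poly N h = (\<Prod>k<N. [:h k, 1:])"

lemma degree_root_poly: "degree (root_poly N h) = N"
  unfolding root_poly_def by (subst degree_prod_sum_eq) auto

lemma lead_coeff_root_poly: "lead_coeff (root_poly N h) = 1"
  unfolding root_poly_def by (simp add: lead_coeff_prod)

lemma root_poly_cnj: "poly (root_poly N (\<lambda>k. cnj (h k))) x = cnj (poly (root_poly N h) (cnj x))"
  by (simp add: root_poly_def poly_prod)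

lemma conj_invariant_imp_root_poly_eq:
  assumes "conj_invariant N h"
  shows "root_poly N (\<lambda>k. cnj (h k)) = root_poly N h"
proof -
  obtain \<sigma> where s: "bij_betw \<sigma> {..<N} {..<N}" "\<And>i. i < N \<Longrightarrow> cnj (h i) = h (\<sigma> i)"
    using assms by (auto simp: conj_invariant_def)
  have "root_poly N (\<lambda>k. cnj (h k)) = (\<Prod>k<N. [:h (\<sigma> k), 1:])"
    unfolding root_poly_def using s(2) by (intro prod.cong) auto
  also have "\<dots> = root_poly N h"
    unfolding root_poly_def by (rule prod.reindex_bij_betw[OF s(1)])
  finally show ?thesis .
qed

text \<open>Equal polynomials have equal root multisets; two families over the same finite index set
  with equal multisets of values differ by a permutation.\<close>

lemma root_poly_eq_imp_conj_invariant:
  assumes "root_poly N (\<lambda>k. cnj (h k)) = root_poly N h"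
  shows "conj_invariant N h"
proof -
  have roots: "proots (root_poly N c) = image_mset (\<lambda>k. - c k) (mset_set {..<N})" for c
  proof -
    have "proots (root_poly N c) = (\<Sum>k<N. proots [:c k, 1:])"
      unfolding root_poly_def by (rule proots_prod) auto
    also have "\<dots> = (\<Sum>k<N. {#- c k#})"
      by simp
    finally show ?thesis
      by (simp add: sum_unfold_sum_mset flip: image_mset.compositionality)
  qed
  have "image_mset (\<lambda>k. - cnj (h k)) (mset_set {..<N}) = image_mset (\<lambda>k. - h k) (mset_set {..<N})"
    using assms roots[of h] roots[of "\<lambda>k. cnj (h k)"] by simp
  then obtain \<sigma> where "\<sigma> permutes {..<N}" "\<forall>k\<in>{..<N}. - cnj (h k) = - h (\<sigma> k)"
    by (rule image_mset_eq_implies_permutes[rotated]) auto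
  then show ?thesis
    unfolding conj_invariant_def by (intro exI[of _ \<sigma>]) (auto simp: permutes_imp_bij)
qed

text \<open>The difference d satisfies \<open>p * pderiv d = d * pderiv p\<close> as well. Leading
  coefficients then give d the degree N, although the leading terms of p and q cancel in it.\<close>

lemma monic_eq_of_wronskian_zero:
  fixes p q :: "complex poly"
  assumes deg: "degree p = N" "degree q = N" and monic: "lead_coeff p = 1" "lead_coeff q = 1"
    and W: "p * pderiv q = q * pderiv p"
  shows "p = q"
proof (rule ccontr)
  assume "p \<noteq> q"
  define d where "d = p - q"
  have d: "d \<noteq> 0"
    using \<open>p \<noteq> q\<close> by (simp add: d_def)
  have "p * pderiv d = d * pderiv p"
    using W by (simp add: d_def pderiv_diff algebra_simps)
  then have "lead_coeff p * lead_coeff (pderiv d) = lead_coeff d * lead_coeff (pderiv p)"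
    by (metis lead_coeff_mult)
  moreover have lc: "lead_coeff (pderiv r) = of_nat (degree r) * lead_coeff r" for r :: "complex poly"
    by (cases "degree r") (auto simp: coeff_pderiv degree_pderiv coeff_eq_0)
  ultimately have "of_nat (degree d) * lead_coeff d = of_nat N * lead_coeff d"
    using monic deg by (simp add: mult.commute)
  then have "degree d = N"
    using d by simp
  moreover have "coeff d N = 0"
    using deg monic by (simp add: d_def)
  ultimately show False
    using d by (metis leading_coeff_0_iff)
qed

text \<open>Substituting \<open>cos z = x * csinc z\<close> extracts one factor
  \<open>csinc z\<close> from every entry. The rest follows from \<open>h j * x - z\<^sup>2 = x * (x
  + h j) - (x\<^sup>2 + z\<^sup>2)\<close>, since the products omitting one factor add up to the
  derivative of the polynomial.\<close>

lemma secular_eq: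
  assumes "csinc z \<noteq> 0"
  defines "x \<equiv> cos z / csinc z"
  shows "secular N h z = csinc z ^ N *
    (of_nat N * x * poly (root_poly N h) x - (x\<^sup>2 + z\<^sup>2) * poly (pderiv (root_poly N h)) x)"
proof -
  define p where "p = root_poly N h"
  define P where "P = (\<lambda>j. \<Prod>k\<in>{..<N} - {j}. x + h k)"
  have c: "cos z = x * csinc z"
    using assms by (simp add: x_def)
  have P: "poly p x = (x + h j) * P j" if "j < N" for j
    using that by (simp add: p_def root_poly_def poly_prod P_def prod.remove[of _ j] add.commute distrib_right)
  have p': "poly (pderiv p) x = (\<Sum>j<N. P j)"
    by (simp add: p_def root_poly_def pderiv_prod poly_sum poly_prod P_def pderiv_pCons add.commute)
  have "(h j * cos z - z\<^sup>2 * csinc z) * (\<Prod>k\<in>{..<N} - {j}. cos z + h k * csinc z)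
      = csinc z ^ N * (x * poly p x - (x\<^sup>2 + z\<^sup>2) * P j)" if "j < N" for j
  proof -
    have "(\<Prod>k\<in>{..<N} - {j}. cos z + h k * csinc z) = (\<Prod>k\<in>{..<N} - {j}. csinc z * (x + h k))"
      by (intro prod.cong) (auto simp: c algebra_simps)
    also have "\<dots> = csinc z ^ (N - 1) * P j"
      using that by (simp add: P_def prod.distrib)
    finally have "(h j * cos z - z\<^sup>2 * csinc z) * (\<Prod>k\<in>{..<N} - {j}. cos z + h k * csinc z)
        = (csinc z * csinc z ^ (N - 1)) * ((h j * x - z\<^sup>2) * P j)"
      by (simp add: c algebra_simps)
    also have "csinc z * csinc z ^ (N - 1) = csinc z ^ N"
      using that by (cases N) auto
    also have "(h j * x - z\<^sup>2) * P j = x * poly p x - (x\<^sup>2 + z\<^sup>2) * P j"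
      unfolding P[OF that] by (simp add: algebra_simps power2_eq_square)
    finally show ?thesis .
  qed
  then have "secular N h z = (\<Sum>j<N. csinc z ^ N * (x * poly p x - (x\<^sup>2 + z\<^sup>2) * P j))"
    unfolding secular_def star_det_def by (intro sum.cong) auto
  also have "\<dots> = csinc z ^ N * (of_nat N * x * poly p x - (x\<^sup>2 + z\<^sup>2) * (\<Sum>j<N. P j))"
    by (simp add: sum_distrib_left[symmetric] sum_subtractf)
  finally show ?thesis
    by (simp only: p'[symmetric] p_def)
qed

lemma secular_zero_iff:
  assumes "csinc z \<noteq> 0" "x = cos z / csinc z"
  shows "secular N h z = 0 \<longleftrightarrow>
    of_nat N * x * poly (root_poly N h) x = (x\<^sup>2 + z\<^sup>2) * poly (pderiv (root_poly N h)) x"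
  unfolding assms(2) secular_eq[OF assms(1)] mult_eq_0_iff right_minus_eq
  using assms(1) by (simp only: power_eq_0_iff simp_thms)

lemma secular_cnj: "secular N (\<lambda>k. cnj (h k)) (cnj z) = cnj (secular N h z)"
  by (simp add: secular_def star_det_def csinc_cnj cnj_cos)

text \<open>The secular function depends on h only through \<open>root_poly\<close> where
  \<open>csinc\<close> is nonzero, and only through the sum of the parameters where it vanishes.
  Conjugation of an invariant tuple changes neither.\<close>

lemma conj_invariant_imp_secular_cnj:
  assumes "conj_invariant N h"
  shows "secular N h (cnj z) = cnj (secular N h z)"
proof -
  have "secular N (\<lambda>k. cnj (h k)) (cnj z) = secular N h (cnj z)"
  proof (cases "csinc (cnj z) = 0")
    case False
    then show ?thesis
      using secular_eq[OF False] by (simp add: conj_invariant_imp_root_poly_eq[OF assms])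
  next
    case True
    obtain \<sigma> where s: "bij_betw \<sigma> {..<N} {..<N}" "\<And>i. i < N \<Longrightarrow> cnj (h i) = h (\<sigma> i)"
      using assms by (auto simp: conj_invariant_def)
    have "(\<Sum>j<N. cnj (h j)) = (\<Sum>j<N. h (\<sigma> j))"
      using s(2) by (intro sum.cong) auto
    also have "\<dots> = (\<Sum>j<N. h j)"
      by (rule sum.reindex_bij_betw[OF s(1)])
    finally have "(\<Sum>j<N. cnj (h j)) = (\<Sum>j<N. h j)" .
    moreover have "secular N c (cnj z) = (\<Sum>j<N. c j) * (cos (cnj z) * cos (cnj z) ^ (N - 1))" for c
      unfolding sum_distrib_right by (simp add: secular_def star_det_def True mult.assoc)
    ultimately show ?thesis
      by simp
  qed
  then show ?thesis
    by (simp add: secular_cnj)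
qed

section \<open>Recovering conjugation invariance from a symmetric spectrum\<close>

lemma quotient_identity:
  assumes "csinc z \<noteq> 0" "x = cos z / csinc z"
  shows "(x\<^sup>2 + z\<^sup>2) * (csinc z)\<^sup>2 = 1"
proof -
  have "(x\<^sup>2 + z\<^sup>2) * (csinc z)\<^sup>2 = (cos z)\<^sup>2 + z\<^sup>2 * (csinc z)\<^sup>2"
    using assms(1) by (simp add: assms(2) power_divide distrib_right)
  then show ?thesis
    by (simp add: cos_csinc_squared)
qed

text \<open>At a root r of p, comparing orders of vanishing in the differential equation forces
  the quadratic factor to vanish as well.\<close>

lemma quadratic_root:
  fixes p :: "complex poly"
  assumes ode: "smult c ([:0, 1:] * p) = [:e, 0, 1:] * pderiv p" and "p \<noteq> 0" and r: "poly p r = 0"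
  shows "r\<^sup>2 = - e"
proof (rule ccontr)
  assume ne: "r\<^sup>2 \<noteq> - e"
  have p': "pderiv p \<noteq> 0"
    using \<open>p \<noteq> 0\<close> r by (cases "degree p = 0") (auto simp: pderiv_eq_0_iff elim!: degree_eq_zeroE)
  have e: "poly [:e, 0, 1:] r \<noteq> 0"
    using ne by (simp add: power2_eq_square eq_neg_iff_add_eq_0 add.commute)
  have "[:-r, 1:] ^ order r p dvd smult c ([:0, 1:] * p)"
    by (intro dvd_smult dvd_mult order_1)
  then have "order r p \<le> order r ([:e, 0, 1:] * pderiv p)"
    unfolding ode using p' by (subst (asm) order_divides) (auto simp del: mult_pCons_left)
  also have "\<dots> = order r [:e, 0, 1:] + order r (pderiv p)"
    using p' by (intro order_mult) (auto simp del: mult_pCons_left)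
  also have "order r [:e, 0, 1:] = 0"
    using e by (rule order_0I)
  also have "0 + order r (pderiv p) < order r p"
    using order_pderiv[OF \<open>p \<noteq> 0\<close> r] by simp
  finally show False
    by simp
qed

lemma symmetric_secular_imp_root_poly_eq:
  assumes N: "N \<ge> 1"
    and sym: "\<And>z. secular N h z = 0 \<Longrightarrow> secular N h (cnj z) = 0"
  shows "root_poly N (\<lambda>k. cnj (h k)) = root_poly N h"
proof -
  define p where "p = root_poly N h"
  define q where "q = root_poly N (\<lambda>k. cnj (h k))"
  have degs: "degree p = N" "degree q = N" "lead_coeff p = 1" "lead_coeff q = 1"
    unfolding p_def q_def by (rule degree_root_poly lead_coeff_root_poly)+
  have p0: "p \<noteq> 0" "q \<noteq> 0"
    using degs by auto
  \<comment> \<open>Symmetry moves the zero from z to \<open>cnj z\<close>; conjugating the whole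
    secular function moves it back to z but with conjugated parameters.\<close>
  have q: "of_nat N * x * poly q x = (x\<^sup>2 + z\<^sup>2) * poly (pderiv q) x"
    if "csinc z \<noteq> 0" "x = cos z / csinc z" "secular N h z = 0" for x z
  proof -
    have "secular N (\<lambda>k. cnj (h k)) z = 0"
      using sym[OF that(3)] secular_cnj[of N h "cnj z"] by simp
    then show ?thesis
      using secular_zero_iff[OF that(1,2)] by (simp add: q_def)
  qed
  have p: "secular N h z = 0 \<longleftrightarrow> of_nat N * x * poly p x = (x\<^sup>2 + z\<^sup>2) * poly (pderiv p) x"
    if "csinc z \<noteq> 0" "x = cos z / csinc z" for x z
    using secular_zero_iff[OF that] by (simp add: p_def)
  have "p * pderiv q = q * pderiv p"
  proof (cases "\<exists>c. smult (of_nat N) ([:0, 1:] * p) = [:c, 0, 1:] * pderiv p")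
    case False
    define X where "X = {x. \<exists>z. csinc z \<noteq> 0 \<and> x = cos z / csinc z \<and>
           of_nat N * x * poly p x = (x\<^sup>2 + z\<^sup>2) * poly (pderiv p) x}"
    have "infinite X"
      unfolding X_def using infinite_quotients[OF degs(1) N degs(3)] False by blast
    moreover have "poly (p * pderiv q - q * pderiv p) x = 0" if "x \<in> X" for x
    proof -
      obtain z where z: "csinc z \<noteq> 0" "x = cos z / csinc z"
        and eq: "of_nat N * x * poly p x = (x\<^sup>2 + z\<^sup>2) * poly (pderiv p) x"
        using \<open>x \<in> X\<close> by (auto simp: X_def)
      have "of_nat N * x * poly q x = (x\<^sup>2 + z\<^sup>2) * poly (pderiv q) x"
        using q[OF z] p[OF z] eq by blast
      then have "(x\<^sup>2 + z\<^sup>2) * (poly p x * poly (pderiv q) x) = (x\<^sup>2 + z\<^sup>2) * (poly q x * poly (pderiv p) x)"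
        using eq by (metis mult.commute mult.left_commute)
      moreover have "x\<^sup>2 + z\<^sup>2 \<noteq> 0"
        using quotient_identity[OF z] by auto
      ultimately show ?thesis
        by simp
    qed
    then have "X \<subseteq> {x. poly (p * pderiv q - q * pderiv p) x = 0}"
      by (intro subsetI CollectI)
    ultimately have "infinite {x. poly (p * pderiv q - q * pderiv p) x = 0}"
      using infinite_super by blast
    then have "p * pderiv q - q * pderiv p = 0"
      using poly_roots_finite by blast
    then show ?thesis
      by simp
  next
    case True
    then obtain c where ode: "smult (of_nat N) ([:0, 1:] * p) = [:c, 0, 1:] * pderiv p"
      by blast
    have ode_at: "of_nat N * x * poly p x = (x\<^sup>2 + c) * poly (pderiv p) x" for x
      using arg_cong[OF ode, of "\<lambda>r. poly r x"] by (simp add: power2_eq_square algebra_simps)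
    have q_at: "poly q x = cnj (poly p (cnj x))" for x
      by (simp add: p_def q_def root_poly_cnj)
    have q_map: "q = map_poly cnj p"
      by (intro poly_ext) (simp add: q_at)
    have odeq: "smult (of_nat N) ([:0, 1:] * q) = [:cnj c, 0, 1:] * pderiv q"
    proof (intro poly_ext)
      fix x
      have "pderiv q = map_poly cnj (pderiv p)"
        unfolding q_map by (intro poly_eqI) (simp add: coeff_pderiv coeff_map_poly)
      then show "poly (smult (of_nat N) ([:0, 1:] * q)) x = poly ([:cnj c, 0, 1:] * pderiv q) x"
        using arg_cong[OF ode_at[of "cnj x"], of cnj]
        by (simp add: q_at power2_eq_square algebra_simps)
    qed
    have c_real: "cnj c = c"
    proof -
      define z where "z = csqrt c"
      have zc: "z\<^sup>2 = c"
        by (simp add: z_def)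
      have c_of_z: "cnj c = c" if "cnj z = z"
        using that zc by (metis complex_cnj_power)
      show ?thesis
      \<comment> \<open>If \<open>csinc z\<close> vanishes there is no quotient, and if
        \<open>cos z\<close> vanishes the quotient is 0 and cannot be cancelled below. In both
        situations z is real, and so is c.\<close>
      proof (cases "csinc z = 0 \<or> cos z = 0")
        case True
        then show ?thesis
          using c_of_z csinc_zero_imp_real cos_zero_imp_real by blast
      next
        case False
        define x where "x = cos (cnj z) / csinc (cnj z)"
        have nz: "csinc (cnj z) \<noteq> 0" "x \<noteq> 0"
          using False by (auto simp: x_def csinc_cnj simp flip: cnj_cos)
        have "secular N h z = 0"
          using False p[of z "cos z / csinc z"] ode_at[of "cos z / csinc z"] by (simp add: zc)
        then have "secular N h (cnj z) = 0"
          by (rule sym)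
        then have "of_nat N * x * poly p x = (x\<^sup>2 + cnj c) * poly (pderiv p) x"
          using p[OF nz(1) x_def] zc by (metis complex_cnj_power)
        then have "(cnj c - c) * poly (pderiv p) x = 0"
          using ode_at[of x] by (simp add: algebra_simps)
        then consider "cnj c = c" | "poly (pderiv p) x = 0"
          by auto
        then show ?thesis
        proof cases
          \<comment> \<open>Here x is a multiple root of p, so every \<zeta> with quotient x is a
            zero of the secular function and also satisfies the equation for q. Two such points with
            different squares force q and its derivative to vanish at x. Comparing
            \<open>quadratic_root\<close> for p and for q gives \<open>c = cnj c\<close>.\<close>
          case 2
          then have px: "poly p x = 0"
            using ode_at[of x] nz(2) N by simp
          have Z: "csinc \<zeta> \<noteq> 0 \<and> x = cos \<zeta> / csinc \<zeta>" if "cos \<zeta> = x * csinc \<zeta>" for \<zeta>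
            using that cos_csinc_squared[of \<zeta>] by (auto simp: field_simps)
          have qz: "of_nat N * x * poly q x = (x\<^sup>2 + \<zeta>\<^sup>2) * poly (pderiv q) x"
            if "cos \<zeta> = x * csinc \<zeta>" for \<zeta>
            using Z[OF that] q[of \<zeta> x] p[of \<zeta> x] px 2 by simp
          obtain \<zeta> where \<zeta>: "cos \<zeta> = x * csinc \<zeta>"
            using infinite_zeros_cos_csinc[of x] infinite_imp_nonempty by fastforce
          obtain \<eta> where \<eta>: "cos \<eta> = x * csinc \<eta>" "\<eta> \<notin> {\<zeta>, - \<zeta>}"
            using infinite_zeros_cos_csinc[of x] finite_subset[of "{z. cos z = x * csinc z}" "{\<zeta>, - \<zeta>}"]
            by auto
          have "\<eta>\<^sup>2 \<noteq> \<zeta>\<^sup>2"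
            using \<eta>(2) by (simp add: power2_eq_iff)
          moreover have "(\<eta>\<^sup>2 - \<zeta>\<^sup>2) * poly (pderiv q) x = 0"
            using qz[OF \<zeta>] qz[OF \<eta>(1)] by (auto simp: algebra_simps)
          ultimately have "poly (pderiv q) x = 0"
            by simp
          then have "poly q x = 0"
            using qz[OF \<zeta>] nz(2) N by simp
          then have "x\<^sup>2 = - cnj c"
            using quadratic_root[OF odeq p0(2)] by blast
          moreover have "x\<^sup>2 = - c"
            using quadratic_root[OF ode p0(1) px] .
          ultimately show ?thesis
            by simp
        qed
      qed
    qed
    \<comment> \<open>Since c is real, p and q satisfy the same differential equation, and the
      common quadratic factor cancels.\<close>
    have "[:c, 0, 1:] * (p * pderiv q) = p * smult (of_nat N) ([:0, 1:] * q)"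
      unfolding odeq c_real by (simp only: mult_ac)
    also have "\<dots> = smult (of_nat N) ([:0, 1:] * p) * q"
      by (simp only: mult_smult_left mult_smult_right mult_ac)
    also have "\<dots> = [:c, 0, 1:] * (q * pderiv p)"
      unfolding ode by (simp only: mult_ac)
    finally show ?thesis
      by (simp del: mult_pCons_left)
  qed
  then have "p = q"
    using monic_eq_of_wronskian_zero degs by blast
  then show ?thesis
    by (simp add: p_def q_def)
qed

theorem theorem2:
  fixes N :: nat and h :: "nat \<Rightarrow> complex"
  assumes "N \<ge> 1"
  shows "(\<forall>lam. lam \<in> star_spectrum N h \<longleftrightarrow> cnj lam \<in> star_spectrum N h)
         \<longleftrightarrow> conj_invariant N h"
proof
  assume spec: "\<forall>lam. lam \<in> star_spectrum N h \<longleftrightarrow> cnj lam \<in> star_spectrum N h"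
  have "secular N h (cnj z) = 0" if "secular N h z = 0" for z
  proof -
    have "z\<^sup>2 \<in> star_spectrum N h"
      using that star_spectrum_iff_secular[OF assms] by blast
    then have "(cnj z)\<^sup>2 \<in> star_spectrum N h"
      using spec by (metis complex_cnj_power)
    then show ?thesis
      using star_spectrum_iff_secular[OF assms] by blast
  qed
  then show "conj_invariant N h"
    using symmetric_secular_imp_root_poly_eq[OF assms] root_poly_eq_imp_conj_invariant by blast
next
  assume inv: "conj_invariant N h"
  show "\<forall>lam. lam \<in> star_spectrum N h \<longleftrightarrow> cnj lam \<in> star_spectrum N h"
  proof
    fix lam :: complex
    define z where "z = csqrt lam"
    have "lam \<in> star_spectrum N h \<longleftrightarrow> secular N h z = 0"
      using star_spectrum_iff_secular[OF assms, of z h] by (simp add: z_def)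
    moreover have "cnj lam \<in> star_spectrum N h \<longleftrightarrow> secular N h (cnj z) = 0"
      using star_spectrum_iff_secular[OF assms, of "cnj z" h] by (simp add: z_def flip: complex_cnj_power)
    ultimately show "lam \<in> star_spectrum N h \<longleftrightarrow> cnj lam \<in> star_spectrum N h"
      by (simp add: conj_invariant_imp_secular_cnj[OF inv])
  qed
qed

end
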